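(* For every MOY graph $\Gamma$ (with any fixed total ordering of its vertices) and every positive integer $N$, $$F_{\Gamma,N}(q,z,Z)=\mu\left((P_\Gamma(q,q^N,x),q)_N\right),$$ where $F_{\Gamma,N}(q,z,Z)=\sum_{\gamma}\langle\Gamma,\gamma\rangle_N(q)\,z^\gamma Z^\gamma\in\mathbb Z[q^{\pm1/2}]\langle\langle z,Z\rangle\rangle$ (sum over all colorings $\gamma$ of $\Gamma$, monomials in standard order) is the generating series of the MOY evaluations in the $q$-commuting half-edge variables $z,Z$; $P_\Gamma(q,a,x)=\sum_{C\in\mathcal C(\Gamma)}(a^{-1/2}q^{1/2})^{\mathrm{rot}(C)}x_C\in\mathbb Z[q^{\pm1/2},a^{\pm1/2}]\langle x\rangle$ is the cycle polynomial in the $q$-commuting cycle variables $x_C$; $(P_\Gamma(q,a,x),q)_N=\prod_{k=0}^{N-1}P_\Gamma(q,a,q^{k\,\mathrm{rot}(C)}x_C)$ (ordered product, $k$ increasing from left to right), evaluated at $a^{1/2}=q^{N/2}$; and $\mu$ is the monomial algebra homomorphism with $\mu(x_C)=z^CZ^C$.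
   Context: **MOY graphs and colorings.** A MOY graph $\Gamma$ is a planar trivalent graph with oriented edges and no sinks or sources (so each vertex has either one incoming and two outgoing half-edges, or two incoming and one outgoing). Multiple edges, loops, and vertex-free components (oriented circles, each counted as one edge) are allowed. $V(\Gamma)$ and $E(\Gamma)$ are the sets of vertices and edges. A coloring (flow) is a map $\gamma:E(\Gamma)\to\mathbb N=\{0,1,2,\dots\}$ such that at each vertex the sum of the values on the incoming edges equals the sum of the values on the outgoing edges. **Half-edges at a vertex.** At a vertex $v$, let $(v,m)$ be the half-edge that is alone in its direction (the unique incoming or the unique outgoing one), and let $(v,l)$, $(v,r)$ be the other two half-edges, lying respectively on the left and on the right when facing in the direction of the orientation. A vertex-free circle component is regarded as having a single half-edge. **Cycles.** A cycle of $\Gamma$ is a (possibly empty, possibly disconnected) $2$-regular subgraph each of whose components is consistently oriented. $\mathcal C(\Gamma)$ is the set of cycles. The rotation number of a connected cycle is $\mathrm{rot}(C)=1$ if it is oriented counter-clockwise and $-1$ if clockwise; in general $\mathrm{rot}(C)$ is the sum over the connected components of $C$ (so $\mathrm{rot}(\emptyset)=0$). **States.** Let $A_N=\{-\frac{N-1}{2},\dots,\frac{N-3}{2},\frac{N-1}{2}\}$ (an $N$-element set, consecutive elements differing by $1$). A state is a function $\sigma:\mathcal C(\Gamma)\to 2^{A_N}$ (values are subsets of $A_N$) with $\sigma(\emptyset)=\emptyset$ and such that $\sigma(C)\cap\sigma(C')=\emptyset$ whenever two distinct cycles $C$ and $C'$ both contain the same edge. For an edge $e$ or half-edge $h$ put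 $\sigma(e)=\bigcup_{C\ni e}\sigma(C)$, $\sigma(h)=\bigcup_{C\ni h}\sigma(C)$. Let $|\sigma|$ be the flow $|\sigma|(e)=|\sigma(e)|$, and $\mathrm{rot}(\sigma)=\sum_{C}\mathrm{rot}(C)\sum_{x\in\sigma(C)}x$. **MOY evaluation.** For a positive integer $N$ and a coloring $\gamma$, $$\langle\Gamma,\gamma\rangle_N(q)=\sum_{\sigma:\,|\sigma|=\gamma}q^{\mathrm{rot}(\sigma)}\prod_{v\in V(\Gamma)}\mathrm{wt}(v;\sigma),\qquad \mathrm{wt}(v;\sigma)=q^{\frac14(R(v;\sigma)-L(v;\sigma))},$$ where $L(v;\sigma)=|\{(a,b)\in\sigma(v,l)\times\sigma(v,r): a>b\}|$ and $R(v;\sigma)=|\{(a,b)\in\sigma(v,l)\times\sigma(v,r): a<b\}|$. **Half-edge variables.** To each vertex $v$ assign six variables, ordered $z_{v,l}<z_{v,m}<z_{v,r}<Z_{v,r}<Z_{v,m}<Z_{v,l}$. To the half-edge of each vertex-free circle component assign two commuting variables $z,Z$. All variables commute except that $$z_{v,r}z_{v,l}=q^{-1/4}z_{v,l}z_{v,r},\qquad Z_{v,r}Z_{v,l}=q^{-1/4}Z_{v,l}Z_{v,r}\qquad(v\in V(\Gamma)).$$ A total order on $V(\Gamma)$ is fixed, and all variables at $v$ precede all variables at $w$ if $v<w$; this gives a total order of the variables. $\mathbb Z[q^{\pm1/2}]\langle\langle z,Z\rangle\rangle$ denotes formal power series in these $q$-commuting variables. For a coloring $\gamma$, and a half-edge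 $h$ of an edge $e$, put $\gamma(h)=\gamma(e)$; $z^\gamma Z^\gamma$ denotes the monomial $\prod_h z_h^{\gamma(h)}\prod_h Z_h^{\gamma(h)}$ written in the standard (increasing) order. For a cycle $C$, $z^CZ^C$ is this monomial for the indicator function of $C$. **Cycle variables.** The variables $x_C$, $C\in\mathcal C(\Gamma)$, with $x_\emptyset=1$, satisfy $x_Cx_{C'}=q^{\langle C,C'\rangle}x_{C'}x_C$, where $$\langle C,C'\rangle=\tfrac12\left(\#\{v\in V(\Gamma): (v,l)\in C,(v,r)\in C'\}-\#\{v\in V(\Gamma):(v,r)\in C,(v,l)\in C'\}\right).$$ They generate the algebra $\mathbb Z[q^{\pm1/2},a^{\pm1/2}]\langle x\rangle$. There is a well-defined monomial homomorphism $\mu$ with $\mu(x_C)=z^CZ^C$ and $\mu(x_Cx_{C'})=\mu(x_C)\mu(x_{C'})$, linear over the coefficients. The notation $P_\Gamma(q,a,q^{k\,\mathrm{rot}(C)}x_C)$ means that each variable $x_C$ in $P_\Gamma(q,a,x)$ is replaced by $q^{k\,\mathrm{rot}(C)}x_C$.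
   Formalization: States are required to be empty on disconnected cycles, so only connected cycles carry labels; with labels allowed on disconnected cycles the identity fails, e.g. for two disjoint circles and N = 1 (evaluation 2 against coefficient 1). *)

theory Defs
  imports "HOL-Complex_Analysis.Winding_Numbers" "HOL-Library.Poly_Mapping"
    "HOL-Library.Product_Plus" "HOL-Library.Multiset"
begin

section \<open>MOY graphs\<close>

text \<open>The three half-edges at a trivalent vertex: \<open>mid\<close> is the one that is alone in its
  direction.\<close>

datatype slot = lft | mid | rgt

text \<open>A graph embedded in the plane. An edge is an oriented curve, parametrised by \<open>[0,1]\<close>.
  A germ \<open>(e, out)\<close> is an end of the edge \<open>e\<close>: the initial end if \<open>out\<close> holds, so that
  \<open>e\<close> leaves the vertex there, and the final end otherwise.
  The field \<open>germ\<close> names the three ends at each vertex; \<open>moy_graph\<close> below leaves no freedom in it.\<close>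

record ('v, 'e) moy_graph =
  verts :: "'v set"
  edges :: "'e set"
  vpos :: "'v \<Rightarrow> complex"
  curve :: "'e \<Rightarrow> real \<Rightarrow> complex"
  germ :: "'v \<Rightarrow> slot \<Rightarrow> 'e \<times> bool"

definition out_edges :: "('v, 'e) moy_graph \<Rightarrow> 'v \<Rightarrow> 'e set" where
  "out_edges G v = {e \<in> edges G. pathstart (curve G e) = vpos G v}"

definition in_edges :: "('v, 'e) moy_graph \<Rightarrow> 'v \<Rightarrow> 'e set" where
  "in_edges G v = {e \<in> edges G. pathfinish (curve G e) = vpos G v}"

definition circle_edges :: "('v, 'e) moy_graph \<Rightarrow> 'e set" where
  "circle_edges G = {e \<in> edges G. pathstart (curve G e) = pathfinish (curve G e) \<and>
     pathstart (curve G e) \<notin> vpos G ` verts G}"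

text \<open>Loops at a vertex are simple closed curves through that vertex, which is then both the
  start and the end of the curve.\<close>

definition plane_graph :: "('v, 'e) moy_graph \<Rightarrow> bool" where
  "plane_graph G \<longleftrightarrow>
     finite (verts G) \<and> finite (edges G) \<and> inj_on (vpos G) (verts G) \<and>
     (\<forall>e\<in>edges G. simple_path (curve G e)) \<and>
     (\<forall>e\<in>edges G. e \<in> circle_edges G \<or>
        (pathstart (curve G e) \<in> vpos G ` verts G \<and> pathfinish (curve G e) \<in> vpos G ` verts G)) \<and>
     (\<forall>e\<in>edges G. \<forall>t\<in>{0<..<1}. curve G e t \<notin> vpos G ` verts G) \<and>
     (\<forall>e\<in>edges G. \<forall>e'\<in>edges G. e \<noteq> e' \<longrightarrow>
        path_image (curve G e) \<inter> path_image (curve G e') \<subseteq> vpos G ` verts G)"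

definition trivalent_no_sink_source :: "('v, 'e) moy_graph \<Rightarrow> bool" where
  "trivalent_no_sink_source G \<longleftrightarrow> (\<forall>v\<in>verts G.
     (card (in_edges G v) = 1 \<and> card (out_edges G v) = 2) \<or>
     (card (in_edges G v) = 2 \<and> card (out_edges G v) = 1))"

definition germs_at :: "('v, 'e) moy_graph \<Rightarrow> 'v \<Rightarrow> ('e \<times> bool) set" where
  "germs_at G v = out_edges G v \<times> {True} \<union> in_edges G v \<times> {False}"

text \<open>The curve of a germ, starting at the vertex of the germ.\<close>

definition germ_path :: "('v, 'e) moy_graph \<Rightarrow> 'e \<times> bool \<Rightarrow> real \<Rightarrow> complex" where
  "germ_path G h = (if snd h then curve G (fst h) else reversepath (curve G (fst h)))"

definition exit_point :: "(real \<Rightarrow> complex) \<Rightarrow> real \<Rightarrow> complex" where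
  "exit_point p r = p (Inf {t \<in> {0..1}. dist (pathstart p) (p t) = r})"

text \<open>The cyclic order of three ends at a point is the cyclic order of the points at which they
  first meet a small circle around that point. No differentiability is needed.\<close>

definition ccw_germs ::
  "('v, 'e) moy_graph \<Rightarrow> 'v \<Rightarrow> 'e \<times> bool \<Rightarrow> 'e \<times> bool \<Rightarrow> 'e \<times> bool \<Rightarrow> bool" where
  "ccw_germs G v h1 h2 h3 \<longleftrightarrow> (\<forall>\<^sub>F r in at_right 0.
     let w = (\<lambda>h. exit_point (germ_path G h) r - vpos G v)
     in 0 < Arg2pi (w h2 / w h1) \<and> Arg2pi (w h2 / w h1) < Arg2pi (w h3 / w h1))"

text \<open>Facing in the direction of the orientation at a vertex: if \<open>mid\<close> comes in, it lies behind, and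
  the counter-clockwise order is \<open>mid, rgt, lft\<close>; if \<open>mid\<close> goes out, it lies ahead, and
  the counter-clockwise order is \<open>mid, lft, rgt\<close>.\<close>

definition germ_labelling :: "('v, 'e) moy_graph \<Rightarrow> bool" where
  "germ_labelling G \<longleftrightarrow> (\<forall>v\<in>verts G.
     bij_betw (germ G v) UNIV (germs_at G v) \<and>
     snd (germ G v lft) = snd (germ G v rgt) \<and>
     snd (germ G v mid) \<noteq> snd (germ G v lft) \<and>
     (if snd (germ G v mid)
      then ccw_germs G v (germ G v mid) (germ G v lft) (germ G v rgt)
      else ccw_germs G v (germ G v mid) (germ G v rgt) (germ G v lft)))"

definition moy_graph :: "('v, 'e) moy_graph \<Rightarrow> bool" where
  "moy_graph G \<longleftrightarrow> plane_graph G \<and> trivalent_no_sink_source G \<and> germ_labelling G"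

text \<open>Half-edges as index set of the variables: three at each vertex, one for each vertex-free
  circle.\<close>

datatype ('v, 'e) hedge = At 'v slot | Circ 'e

definition hedges :: "('v, 'e) moy_graph \<Rightarrow> ('v, 'e) hedge set" where
  "hedges G = {At v s |v s. v \<in> verts G} \<union> Circ ` circle_edges G"

primrec hedge_edge :: "('v, 'e) moy_graph \<Rightarrow> ('v, 'e) hedge \<Rightarrow> 'e" where
  "hedge_edge G (At v s) = fst (germ G v s)"
| "hedge_edge G (Circ e) = e"

definition colorings :: "('v, 'e) moy_graph \<Rightarrow> ('e \<Rightarrow> nat) set" where
  "colorings G = {c. (\<forall>e. e \<notin> edges G \<longrightarrow> c e = 0) \<and>
     (\<forall>v\<in>verts G. (\<Sum>e\<in>in_edges G v. c e) = (\<Sum>e\<in>out_edges G v. c e))}"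


section \<open>Cycles and rotation numbers\<close>

text \<open>A cycle is given by its set of edges; the vertices of the subgraph are the endpoints of
  these. A vertex has degree 2 in the subgraph or does not lie on it, and
  orientations are consistent along every component iff one edge enters and one leaves at each
  vertex of it.\<close>

definition cycles :: "('v, 'e) moy_graph \<Rightarrow> 'e set set" where
  "cycles G = {C. C \<subseteq> edges G \<and> (\<forall>v\<in>verts G.
     card (in_edges G v \<inter> C) + card (out_edges G v \<inter> C) \<in> {0, 2} \<and>
     card (in_edges G v \<inter> C) = card (out_edges G v \<inter> C))}"

definition support :: "('v, 'e) moy_graph \<Rightarrow> 'e set \<Rightarrow> complex set" where
  "support G C = (\<Union>e\<in>C. path_image (curve G e))"

definition connected_cycle :: "('v, 'e) moy_graph \<Rightarrow> 'e set \<Rightarrow> bool" where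
  "connected_cycle G C \<longleftrightarrow> C \<in> cycles G \<and> C \<noteq> {} \<and> connected (support G C)"

definition cycle_components :: "('v, 'e) moy_graph \<Rightarrow> 'e set \<Rightarrow> 'e set set" where
  "cycle_components G C = {D. D \<subseteq> C \<and> support G D \<in> components (support G C)}"

text \<open>\<open>es\<close> runs once through the edges of \<open>C\<close> along their orientation.\<close>

definition traverses :: "('v, 'e) moy_graph \<Rightarrow> 'e list \<Rightarrow> 'e set \<Rightarrow> bool" where
  "traverses G es C \<longleftrightarrow> es \<noteq> [] \<and> distinct es \<and> set es = C \<and>
     (\<forall>i<length es. pathfinish (curve G (es ! i)) =
                    pathstart (curve G (es ! (Suc i mod length es))))"

fun joined_path :: "('v, 'e) moy_graph \<Rightarrow> 'e list \<Rightarrow> real \<Rightarrow> complex" where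
  "joined_path G [] = (\<lambda>_. 0)"
| "joined_path G [e] = curve G e"
| "joined_path G (e # es) = curve G e +++ joined_path G es"

definition counter_clockwise :: "('v, 'e) moy_graph \<Rightarrow> 'e set \<Rightarrow> bool" where
  "counter_clockwise G C \<longleftrightarrow> (\<exists>es. traverses G es C \<and>
     (\<forall>z\<in>inside (support G C). winding_number (joined_path G es) z = 1))"

definition rot_connected :: "('v, 'e) moy_graph \<Rightarrow> 'e set \<Rightarrow> int" where
  "rot_connected G C = (if counter_clockwise G C then 1 else - 1)"

definition rot :: "('v, 'e) moy_graph \<Rightarrow> 'e set \<Rightarrow> int" where
  "rot G C = (\<Sum>D\<in>cycle_components G C. rot_connected G D)"


section \<open>The coefficient ring\<close>

text \<open>\<open>\<int>[q\<^sup>r, a\<^sup>s]\<close> for rational \<open>r, s\<close>, realised as the group ring of \<open>\<rat> \<times> \<rat>\<close>; it contains the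
  rings \<open>\<int>[q\<^sup>\<plusminus>\<^sup>1\<^sup>/\<^sup>2]\<close> and \<open>\<int>[q\<^sup>\<plusminus>\<^sup>1\<^sup>/\<^sup>2, a\<^sup>\<plusminus>\<^sup>1\<^sup>/\<^sup>2]\<close>, and also the powers of \<open>q\<^sup>1\<^sup>/\<^sup>4\<close>
  in the commutation relations of the half-edge variables and in the vertex weights.\<close>

type_synonym laurent = "(rat \<times> rat) \<Rightarrow>\<^sub>0 int"

definition qp :: "rat \<Rightarrow> laurent" where
  "qp r = Poly_Mapping.single (r, 0) 1"

definition ap :: "rat \<Rightarrow> laurent" where
  "ap s = Poly_Mapping.single (0, s) 1"

definition half_laurent :: "laurent set" where
  "half_laurent = {k. \<forall>x\<in>Poly_Mapping.keys k. snd x = 0 \<and> 2 * fst x \<in> \<int>}"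

text \<open>The substitution \<open>a\<^sup>s \<mapsto> q\<^sup>(\<^sup>n\<^sup>s\<^sup>)\<close>, i.e. \<open>a = q\<^sup>n\<close>.\<close>

definition spec_coeff :: "nat \<Rightarrow> laurent \<Rightarrow> laurent" where
  "spec_coeff n k = (\<Sum>x\<in>Poly_Mapping.keys k.
     Poly_Mapping.single (fst x + of_nat n * snd x, 0) (Poly_Mapping.lookup k x))"

lemma qp_0 [simp]: "qp 0 = 1"
  by (simp add: qp_def flip: zero_prod_def)

lemma qp_add: "qp (r + s) = qp r * qp s"
  by (simp add: qp_def mult_single)

lemma spec_coeff_superset:
  assumes "finite A" "Poly_Mapping.keys k \<subseteq> A"
  shows "spec_coeff n k = (\<Sum>x\<in>A.
     Poly_Mapping.single (fst x + of_nat n * snd x, 0) (Poly_Mapping.lookup k x))"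
  unfolding spec_coeff_def
  by (rule sum.mono_neutral_left) (use assms in \<open>auto simp: in_keys_iff\<close>)

lemma spec_coeff_single [simp]:
  "spec_coeff n (Poly_Mapping.single x c) = Poly_Mapping.single (fst x + of_nat n * snd x, 0) c"
  by (cases "c = 0") (auto simp: spec_coeff_def)

lemma spec_coeff_add: "spec_coeff n (k + l) = spec_coeff n k + spec_coeff n l"
proof -
  let ?A = "Poly_Mapping.keys k \<union> Poly_Mapping.keys l"
  have "Poly_Mapping.keys (k + l) \<subseteq> ?A"
    by (rule Poly_Mapping.keys_add)
  then show ?thesis
    by (subst (1 2 3) spec_coeff_superset[of ?A])
       (auto simp: lookup_add single_add sum.distrib)
qed

lemma spec_coeff_0 [simp]: "spec_coeff n 0 = 0"
  by (simp add: spec_coeff_def)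

lemma spec_coeff_1 [simp]: "spec_coeff n 1 = 1"
  by (simp add: spec_coeff_single[where x="0" and c=1, simplified] flip: single_one zero_prod_def)

lemma laurent_induct [case_names single add]:
  fixes k :: laurent
  assumes "\<And>x c. P (Poly_Mapping.single x c)" and "\<And>k l. P k \<Longrightarrow> P l \<Longrightarrow> P (k + l)"
  shows "P k"
proof -
  have *: "k = (\<Sum>x\<in>Poly_Mapping.keys k. Poly_Mapping.single x (Poly_Mapping.lookup k x))"
    by (rule poly_mapping_eqI) (simp add: lookup_sum lookup_single when_def in_keys_iff)
  have "finite A \<Longrightarrow> P (\<Sum>x\<in>A. Poly_Mapping.single x (Poly_Mapping.lookup k x))" for A
  proof (induction A rule: finite_induct)
    case empty
    show ?case using assms(1)[of 0 0] by simp
  next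
    case (insert x A)
    then show ?case by (simp add: assms)
  qed
  from this[OF finite_keys] show ?thesis by (subst *)
qed

lemma spec_coeff_mult: "spec_coeff n (k * l) = spec_coeff n k * spec_coeff n l"
proof (induction k rule: laurent_induct)
  case (single x c)
  show ?case
    by (induction l rule: laurent_induct)
       (simp_all add: mult_single spec_coeff_add ring_distribs add_ac)
qed (simp add: spec_coeff_add ring_distribs)

lemma spec_coeff_qp [simp]: "spec_coeff n (qp r) = qp r"
  by (simp add: qp_def)

lemma spec_coeff_ap [simp]: "spec_coeff n (ap s) = qp (of_nat n * s)"
  by (simp add: qp_def ap_def)


section \<open>Power series in the half-edge variables\<close>

text \<open>\<open>Lo h\<close> is the variable \<open>z\<^sub>h\<close> and \<open>Up h\<close> the variable \<open>Z\<^sub>h\<close>.\<close>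

datatype ('v, 'e) hvar = Lo (base: "('v, 'e) hedge") | Up (base: "('v, 'e) hedge")

text \<open>A series is given by its coefficients with respect to the monomials in standard order. The
  product of the standard monomials with exponents \<open>A\<close> and \<open>B\<close> is \<open>q\<close> to the power
  \<open>reorder A B\<close> times the one with exponents \<open>A + B\<close>: the pairs that have to be
  interchanged and do not commute are \<open>Z\<^sub>v\<^sub>,\<^sub>l Z\<^sub>v\<^sub>,\<^sub>r = q\<^sup>1\<^sup>/\<^sup>4 Z\<^sub>v\<^sub>,\<^sub>r Z\<^sub>v\<^sub>,\<^sub>l\<close> and
  \<open>z\<^sub>v\<^sub>,\<^sub>r z\<^sub>v\<^sub>,\<^sub>l = q\<^sup>-\<^sup>1\<^sup>/\<^sup>4 z\<^sub>v\<^sub>,\<^sub>l z\<^sub>v\<^sub>,\<^sub>r\<close>.\<close>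

definition reorder :: "('v, 'e) hvar multiset \<Rightarrow> ('v, 'e) hvar multiset \<Rightarrow> rat" where
  "reorder A B = Sum_any (\<lambda>v.
     (of_nat (count A (Up (At v lft)) * count B (Up (At v rgt))) -
      of_nat (count A (Lo (At v rgt)) * count B (Lo (At v lft)))) / 4)"

typedef ('v, 'e) qseries = "UNIV :: (('v, 'e) hvar multiset \<Rightarrow> laurent) set"
  morphisms scoeff Series
  by simp

setup_lifting type_definition_qseries

lemma qseries_eqI: "(\<And>M. scoeff f M = scoeff g M) \<Longrightarrow> f = g"
  by transfer auto

definition splits :: "'a multiset \<Rightarrow> ('a multiset \<times> 'a multiset) set" where
  "splits M = {(A, B). A + B = M}"

lemma finite_submultisets: "finite {A. A \<subseteq># M}"
proof (induction M)
  case (add x M)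
  have "{A. A \<subseteq># add_mset x M} \<subseteq> {A. A \<subseteq># M} \<union> add_mset x ` {A. A \<subseteq># M}"
  proof
    fix A assume A: "A \<in> {A. A \<subseteq># add_mset x M}"
    show "A \<in> {A. A \<subseteq># M} \<union> add_mset x ` {A. A \<subseteq># M}"
    proof (cases "x \<in># A")
      case True
      then obtain B where "A = add_mset x B" by (metis mset_add)
      with A show ?thesis by auto
    next
      case False
      have "count A y \<le> count M y" for y
      proof (cases "y = x")
        case True
        with False show ?thesis by (simp add: not_in_iff)
      next
        case y: False
        from A have "count A y \<le> count (add_mset x M) y"
          by (simp add: subseteq_mset_def)
        with y show ?thesis by simp
      qed
      then have "A \<subseteq># M" by (simp add: subseteq_mset_def)
      then show ?thesis by simp
    qed
  qed
  with add.IH show ?case by (meson finite_UnI finite_imageI finite_subset)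
qed simp

lemma finite_splits [simp]: "finite (splits M)"
proof (rule finite_subset)
  show "splits M \<subseteq> {A. A \<subseteq># M} \<times> {A. A \<subseteq># M}"
    by (auto simp: splits_def)
qed (simp add: finite_submultisets)

lemma finite_count_vimage:
  assumes "inj f"
  shows "finite {v. count A (f v) \<noteq> 0}"
proof -
  have "{v. count A (f v) \<noteq> 0} = f -` set_mset A" by auto
  then show ?thesis using assms by (simp add: finite_vimageI)
qed

lemma finite_reorder:
  "finite {v. (of_nat (count A (Up (At v lft)) * count B (Up (At v rgt))) -
      of_nat (count A (Lo (At v rgt)) * count B (Lo (At v lft)))) / (4::rat) \<noteq> 0}"
  (is "finite ?S")
proof (rule finite_subset)
  show "?S \<subseteq> {v. count A (Up (At v lft)) \<noteq> 0} \<union> {v. count A (Lo (At v rgt)) \<noteq> 0}"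
    by (rule subsetI, rule ccontr) (simp add: not_in_iff)
  show "finite ({v. count A (Up (At v lft)) \<noteq> 0} \<union> {v. count A (Lo (At v rgt)) \<noteq> 0})"
    by (intro finite_UnI finite_count_vimage) (auto simp: inj_def)
qed

lemma reorder_add_left: "reorder (A + A') B = reorder A B + reorder A' B"
  unfolding reorder_def
  by (subst Sum_any.distrib[symmetric, OF finite_reorder finite_reorder])
     (auto intro!: Sum_any.cong simp: algebra_simps add_divide_distrib diff_divide_distrib)

lemma reorder_add_right: "reorder A (B + B') = reorder A B + reorder A B'"
  unfolding reorder_def
  by (subst Sum_any.distrib[symmetric, OF finite_reorder finite_reorder])
     (auto intro!: Sum_any.cong simp: algebra_simps add_divide_distrib diff_divide_distrib)

lemma reorder_empty [simp]: "reorder {#} B = 0" "reorder A {#} = 0"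
  by (simp_all add: reorder_def)

instantiation qseries :: (type, type) ring_1
begin

lift_definition zero_qseries :: "('a, 'b) qseries" is "\<lambda>_. 0" .
lift_definition one_qseries :: "('a, 'b) qseries" is "\<lambda>M. if M = {#} then 1 else 0" .
lift_definition plus_qseries :: "('a, 'b) qseries \<Rightarrow> ('a, 'b) qseries \<Rightarrow> ('a, 'b) qseries"
  is "\<lambda>f g M. f M + g M" .
lift_definition minus_qseries :: "('a, 'b) qseries \<Rightarrow> ('a, 'b) qseries \<Rightarrow> ('a, 'b) qseries"
  is "\<lambda>f g M. f M - g M" .
lift_definition uminus_qseries :: "('a, 'b) qseries \<Rightarrow> ('a, 'b) qseries"
  is "\<lambda>f M. - f M" .
lift_definition times_qseries :: "('a, 'b) qseries \<Rightarrow> ('a, 'b) qseries \<Rightarrow> ('a, 'b) qseries"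
  is "\<lambda>f g M. \<Sum>(A, B)\<in>splits M. qp (reorder A B) * f A * g B" .

instance
proof
  fix f g h :: "('a, 'b) qseries"
  show "f + g + h = f + (g + h)" by transfer (simp add: add.assoc)
  show "f + g = g + f" by transfer (simp add: add.commute)
  show "0 + f = f" by transfer simp
  show "- f + f = 0" by transfer simp
  show "f - g = f + - g" by transfer simp
  show "(0::('a, 'b) qseries) \<noteq> 1" by transfer (metis zero_neq_one)
  show "(f + g) * h = f * h + g * h"
    by transfer (simp add: algebra_simps sum.distrib split_beta)
  show "f * (g + h) = f * g + f * h"
    by transfer (simp add: algebra_simps sum.distrib split_beta)
  show "1 * f = f"
  proof (transfer, rule ext)
    fix f :: "('a, 'b) hvar multiset \<Rightarrow> laurent" and M
    have "(\<Sum>(A, B)\<in>splits M. qp (reorder A B) * (if A = {#} then 1 else 0) * f B) =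
          (\<Sum>(A, B)\<in>{({#}, M)}. qp (reorder A B) * (if A = {#} then 1 else 0) * f B)"
      by (rule sum.mono_neutral_right) (simp, simp add: splits_def, auto simp: splits_def split: if_splits)
    then show "(\<Sum>(A, B)\<in>splits M. qp (reorder A B) * (if A = {#} then 1 else 0) * f B) = f M"
      by simp
  qed
  show "f * 1 = f"
  proof (transfer, rule ext)
    fix f :: "('a, 'b) hvar multiset \<Rightarrow> laurent" and M
    have "(\<Sum>(A, B)\<in>splits M. qp (reorder A B) * f A * (if B = {#} then 1 else 0)) =
          (\<Sum>(A, B)\<in>{(M, {#})}. qp (reorder A B) * f A * (if B = {#} then 1 else 0))"
      by (rule sum.mono_neutral_right) (simp, simp add: splits_def, auto simp: splits_def split: if_splits)
    then show "(\<Sum>(A, B)\<in>splits M. qp (reorder A B) * f A * (if B = {#} then 1 else 0)) = f M"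
      by simp
  qed
  show "f * g * h = f * (g * h)"
  proof (transfer, rule ext)
    fix f g h :: "('a, 'b) hvar multiset \<Rightarrow> laurent" and M
    let ?t = "\<lambda>A B C. qp (reorder A B + reorder A C + reorder B C) * f A * g B * h C"
    have "(\<Sum>(X, C)\<in>splits M. qp (reorder X C) *
            (\<Sum>(A, B)\<in>splits X. qp (reorder A B) * f A * g B) * h C) =
          (\<Sum>x\<in>splits M. \<Sum>y\<in>splits (fst x). ?t (fst y) (snd y) (snd x))"
      by (intro sum.cong refl, auto simp: sum_distrib_left sum_distrib_right split_beta splits_def
          reorder_add_left qp_add intro!: sum.cong)
    also have "\<dots> = (\<Sum>p\<in>(SIGMA x:splits M. splits (fst x)).
                  ?t (fst (snd p)) (snd (snd p)) (snd (fst p)))"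
      by (subst sum.Sigma) (simp_all add: split_beta)
    also have "\<dots> = (\<Sum>p\<in>(SIGMA x:splits M. splits (snd x)).
                  ?t (fst (fst p)) (fst (snd p)) (snd (snd p)))"
      by (rule sum.reindex_bij_witness
          [where i = "\<lambda>((A, Y), (B, C)). ((A + B, C), (A, B))"
             and j = "\<lambda>((X, C), (A, B)). ((A, B + C), (B, C))"])
         (auto simp: splits_def add_ac)
    also have "\<dots> = (\<Sum>x\<in>splits M. \<Sum>y\<in>splits (snd x). ?t (fst x) (fst y) (snd y))"
      by (subst sum.Sigma) (simp_all add: split_beta)
    also have "\<dots> = (\<Sum>(A, Y)\<in>splits M. qp (reorder A Y) * f A *
            (\<Sum>(B, C)\<in>splits Y. qp (reorder B C) * g B * h C))"
      by (intro sum.cong refl, auto simp: sum_distrib_left sum_distrib_right split_beta splits_def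
          reorder_add_right qp_add mult_ac intro!: sum.cong)
    finally show "(\<Sum>(X, C)\<in>splits M. qp (reorder X C) *
            (\<Sum>(A, B)\<in>splits X. qp (reorder A B) * f A * g B) * h C) =
        (\<Sum>(A, Y)\<in>splits M. qp (reorder A Y) * f A *
            (\<Sum>(B, C)\<in>splits Y. qp (reorder B C) * g B * h C))" .
  qed
qed

end

text \<open>\<open>basis c M\<close> is \<open>c\<close> times the standard monomial with exponents \<open>M\<close>.\<close>

definition basis :: "laurent \<Rightarrow> ('v, 'e) hvar multiset \<Rightarrow> ('v, 'e) qseries" where
  "basis c M = Series (\<lambda>X. if X = M then c else 0)"

definition const :: "laurent \<Rightarrow> ('v, 'e) qseries" where
  "const c = basis c {#}"

definition hv :: "('v, 'e) hvar \<Rightarrow> ('v, 'e) qseries" where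
  "hv u = basis 1 {#u#}"

lemma scoeff_basis [simp]: "scoeff (basis c M) X = (if X = M then c else 0)"
  by (simp add: basis_def Series_inverse)

lemma basis_mult: "basis c A * basis d B = basis (qp (reorder A B) * c * d) (A + B)"
proof (rule qseries_eqI)
  fix X
  have "scoeff (basis c A * basis d B) X =
    (\<Sum>p\<in>splits X. if p = (A, B) then qp (reorder A B) * c * d else 0)"
    by (auto simp: times_qseries.rep_eq split_beta prod_eq_iff intro!: sum.cong)
  also have "\<dots> = scoeff (basis (qp (reorder A B) * c * d) (A + B)) X"
    by (subst sum.delta) (simp, auto simp: splits_def)
  finally show "scoeff (basis c A * basis d B) X =
    scoeff (basis (qp (reorder A B) * c * d) (A + B)) X" .
qed

lemma basis_add: "basis (c + d) A = basis c A + basis d A"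
  by (rule qseries_eqI) (simp add: plus_qseries.rep_eq)

lemma basis_one: "basis 1 {#} = 1"
  by (rule qseries_eqI) (simp add: one_qseries.rep_eq)

lemma const_mult_basis: "const c * basis d A = basis (c * d) A"
  by (simp add: const_def basis_mult)

lemma scoeff_const_mult [simp]: "scoeff (const c * f) M = c * scoeff f M"
proof -
  have "scoeff (const c * f) M = (\<Sum>p\<in>splits M. if p = ({#}, M) then c * scoeff f M else 0)"
    by (auto simp: const_def times_qseries.rep_eq split_beta prod_eq_iff splits_def intro!: sum.cong)
  then show ?thesis by (subst (asm) sum.delta) (simp, simp add: splits_def)
qed

lemma scoeff_mult_const [simp]: "scoeff (f * const c) M = c * scoeff f M"
proof -
  have "scoeff (f * const c) M = (\<Sum>p\<in>splits M. if p = (M, {#}) then c * scoeff f M else 0)"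
    by (auto simp: const_def times_qseries.rep_eq split_beta prod_eq_iff splits_def intro!: sum.cong)
  then show ?thesis by (subst (asm) sum.delta) (simp, simp add: splits_def)
qed

lemma const_central: "const c * f = f * const c"
  by (rule qseries_eqI) simp

lemma const_add: "const (c + d) = const c + const d"
  by (simp add: const_def basis_add)

lemma const_mult: "const (c * d) = const c * const d"
  by (simp add: const_def basis_mult)

lemma const_0 [simp]: "const 0 = 0"
  by (rule qseries_eqI) (simp add: const_def zero_qseries.rep_eq)

lemma const_1 [simp]: "const 1 = 1"
  by (simp add: const_def basis_one)

lemma reorder_single:
  fixes u w :: "('a, 'b) hvar"
  shows
  "reorder {#u#} {#w#} =
     (if \<exists>v. u = Up (At v lft) \<and> w = Up (At v rgt) then 1/4
      else if \<exists>v. u = Lo (At v rgt) \<and> w = Lo (At v lft) then - 1/4 else 0)"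
proof (cases "\<exists>v. (u = Up (At v lft) \<and> w = Up (At v rgt)) \<or> (u = Lo (At v rgt) \<and> w = Lo (At v lft))")
  case True
  then obtain v where
    v: "(u = Up (At v lft) \<and> w = Up (At v rgt)) \<or> (u = Lo (At v rgt) \<and> w = Lo (At v lft))" by blast
  show ?thesis
    unfolding reorder_def
    by (subst Sum_any.expand_superset[of "{v}"]) (use v in \<open>auto split: if_splits\<close>)
next
  case False
  have "reorder {#u#} {#w#} = Sum_any (\<lambda>v::'a. 0)"
    unfolding reorder_def by (rule Sum_any.cong) (use False in auto)
  with False show ?thesis by auto
qed

lemma hv_lower_relation:
  "hv (Lo (At v rgt)) * hv (Lo (At v lft)) =
   const (qp (- 1/4)) * (hv (Lo (At v lft)) * hv (Lo (At v rgt)))"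
  by (simp add: hv_def basis_mult const_mult_basis reorder_single add_mset_commute)

lemma hv_upper_relation:
  "hv (Up (At v rgt)) * hv (Up (At v lft)) =
   const (qp (- 1/4)) * (hv (Up (At v lft)) * hv (Up (At v rgt)))"
  by (simp add: hv_def basis_mult const_mult_basis reorder_single add_mset_commute flip: qp_add)

lemma hv_commute:
  assumes "\<And>v. {u, w} \<noteq> {Lo (At v lft), Lo (At v rgt)}" "\<And>v. {u, w} \<noteq> {Up (At v lft), Up (At v rgt)}"
  shows "hv u * hv w = hv w * hv u"
proof -
  have "reorder {#u#} {#w#} = 0" "reorder {#w#} {#u#} = 0"
    using assms by (auto simp: reorder_single)
  then show ?thesis by (simp add: hv_def basis_mult add_mset_commute)
qed

text \<open>The sum of a family of series of which only finitely many contribute to each coefficient.\<close>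

definition formal_sum :: "('i \<Rightarrow> ('v, 'e) qseries) \<Rightarrow> 'i set \<Rightarrow> ('v, 'e) qseries" where
  "formal_sum f I = Series (\<lambda>M. \<Sum>i\<in>{i \<in> I. scoeff (f i) M \<noteq> 0}. scoeff (f i) M)"

text \<open>The variables of the half-edges in the support of \<open>n\<close>, in standard order. The
  variables of vertex-free circles are central; we put them last.\<close>

definition var_list :: "(('v::linorder, 'e::linorder) hedge \<Rightarrow> nat) \<Rightarrow> ('v, 'e) hvar list" where
  "var_list n =
     concat (map (\<lambda>v. [Lo (At v lft), Lo (At v mid), Lo (At v rgt),
                       Up (At v rgt), Up (At v mid), Up (At v lft)])
       (sorted_list_of_set {v. \<exists>s. n (At v s) \<noteq> 0})) @
     concat (map (\<lambda>e. [Lo (Circ e), Up (Circ e)]) (sorted_list_of_set {e. n (Circ e) \<noteq> 0}))"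

text \<open>The monomial \<open>z\<^sup>n Z\<^sup>n\<close> as the product in standard order.\<close>

definition std_monomial :: "(('v::linorder, 'e::linorder) hedge \<Rightarrow> nat) \<Rightarrow> ('v, 'e) qseries" where
  "std_monomial n = prod_list (map (\<lambda>u. hv u ^ n (base u)) (var_list n))"


text \<open>\<open>std_monomial n\<close> is the basis element with exponents \<open>n\<close>; in particular it does not depend
  on the order of the vertices.\<close>

definition hedge_mset :: "(('v, 'e) hedge \<Rightarrow> nat) \<Rightarrow> ('v, 'e) hvar multiset" where
  "hedge_mset n = (\<Sum>h\<in>{h. n h \<noteq> 0}. replicate_mset (n h) (Lo h) + replicate_mset (n h) (Up h))"

lemma reorder_add_mset_left: "reorder (add_mset u A) B = reorder {#u#} B + reorder A B"
  using reorder_add_left[of "{#u#}" A B] by simp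

lemma reorder_add_mset_right: "reorder A (add_mset w B) = reorder A {#w#} + reorder A B"
  using reorder_add_right[of A "{#w#}" B] by simp

lemma reorder_replicate: "reorder (replicate_mset k u) (replicate_mset l w) =
  of_nat k * of_nat l * reorder {#u#} {#w#}"
proof -
  have *: "reorder {#u#} (replicate_mset l w) = of_nat l * reorder {#u#} {#w#}"
  proof (induction l)
    case (Suc l)
    then show ?case
      using reorder_add_mset_right[of "{#u#}" w "replicate_mset l w"] by (simp add: algebra_simps)
  qed simp
  show ?thesis
  proof (induction k)
    case (Suc k)
    then show ?case
      using reorder_add_mset_left[of u "replicate_mset k u" "replicate_mset l w"]
      by (simp add: * algebra_simps)
  qed simp
qed

lemma hv_power: "hv u ^ k = basis 1 (replicate_mset k u)"
proof (induction k)
  case (Suc k)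
  have "reorder {#u#} (replicate_mset k u) = 0"
    using reorder_replicate[of 1 u k u] by (auto simp: reorder_single)
  with Suc show ?case by (simp add: hv_def basis_mult)
qed (simp add: basis_one)

lemma reorder_sum_mset_zero:
  assumes "\<And>u w. u \<in># A \<Longrightarrow> w \<in># B \<Longrightarrow> reorder {#u#} {#w#} = 0"
  shows "reorder A B = 0"
proof -
  have *: "reorder {#u#} B = 0" if "\<And>w. w \<in># B \<Longrightarrow> reorder {#u#} {#w#} = 0" for u
    using that
  proof (induction B)
    case (add w B)
    have "reorder {#u#} {#w#} = 0" "reorder {#u#} B = 0"
      by (rule add.prems, simp) (rule add.IH, rule add.prems, simp)
    then show ?case by (simp only: reorder_add_mset_right[of _ w B] add_0)
  qed simp
  from assms show ?thesis
  proof (induction A)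
    case (add u A)
    have "reorder {#u#} B = 0" "reorder A B = 0"
      by (rule *, rule add.prems, simp_all) (rule add.IH, rule add.prems, simp_all)
    then show ?case by (simp only: reorder_add_mset_left[of u A B] add_0)
  qed simp
qed

lemma ordered_prod_basis:
  assumes "sorted_wrt (\<lambda>u w. reorder {#u#} {#w#} = 0) us"
  shows "prod_list (map (\<lambda>u. hv u ^ m u) us) =
         basis 1 (\<Sum>u\<leftarrow>us. replicate_mset (m u) u)"
  using assms
proof (induction us)
  case (Cons u us)
  let ?B = "\<Sum>u\<leftarrow>us. replicate_mset (m u) u"
  have B: "w \<in> set us" if "w \<in># ?B" for w
    using that by (induction us) (auto split: if_splits)
  have "reorder (replicate_mset (m u) u) ?B = 0"
  proof (rule reorder_sum_mset_zero)
    fix x w assume "x \<in># replicate_mset (m u) u" "w \<in># ?B"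
    then have "x = u" "w \<in> set us" by (auto dest: B split: if_splits)
    with Cons.prems show "reorder {#x#} {#w#} = 0" by (simp only: sorted_wrt.simps)
  qed
  moreover have "prod_list (map (\<lambda>u. hv u ^ m u) us) = basis 1 ?B"
    by (rule Cons.IH) (use Cons.prems in \<open>simp only: sorted_wrt.simps\<close>)
  ultimately show ?case by (simp add: hv_power basis_mult)
qed (simp add: basis_one)

lemma sorted_wrt_concat_map:
  assumes "\<And>x. x \<in> set xs \<Longrightarrow> sorted_wrt P (f x)"
    and "sorted_wrt (\<lambda>x y. \<forall>a\<in>set (f x). \<forall>b\<in>set (f y). P a b) xs"
  shows "sorted_wrt P (concat (map f xs))"
  using assms by (induction xs) (auto simp: sorted_wrt_append)

lemma sorted_var_list:
  fixes n :: "('a::linorder, 'b::linorder) hedge \<Rightarrow> nat"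
  shows "sorted_wrt (\<lambda>u w. reorder {#u#} {#w#} = 0) (var_list n)"
  unfolding var_list_def sorted_wrt_append
proof (intro conjI ballI)
  let ?P = "\<lambda>u w :: ('a, 'b) hvar. reorder {#u#} {#w#} = 0"
  show "sorted_wrt ?P (concat (map (\<lambda>v. [Lo (At v lft), Lo (At v mid), Lo (At v rgt),
          Up (At v rgt), Up (At v mid), Up (At v lft)])
        (sorted_list_of_set {v. \<exists>s. n (At v s) \<noteq> 0})))"
  proof (rule sorted_wrt_concat_map)
    show "sorted_wrt (\<lambda>x y. \<forall>a\<in>set [Lo (At x lft), Lo (At x mid), Lo (At x rgt),
              Up (At x rgt), Up (At x mid), Up (At x lft)].
            \<forall>b\<in>set [Lo (At y lft), Lo (At y mid), Lo (At y rgt),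
              Up (At y rgt), Up (At y mid), Up (At y lft)]. ?P a b)
          (sorted_list_of_set {v. \<exists>s. n (At v s) \<noteq> 0})"
      by (rule sorted_wrt_mono_rel[OF _ strict_sorted_list_of_set]) (auto simp: reorder_single)
  qed (simp add: reorder_single)
  show "sorted_wrt ?P (concat (map (\<lambda>e. [Lo (Circ e), Up (Circ e)])
          (sorted_list_of_set {e. n (Circ e) \<noteq> 0})))"
  proof (rule sorted_wrt_concat_map)
    show "sorted_wrt (\<lambda>x y. \<forall>a\<in>set [Lo (Circ x), Up (Circ x)].
            \<forall>b\<in>set [Lo (Circ y), Up (Circ y)]. ?P a b)
          (sorted_list_of_set {e. n (Circ e) \<noteq> 0})"
      by (rule sorted_wrt_mono_rel[OF _ strict_sorted_list_of_set]) (auto simp: reorder_single)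
  qed (simp add: reorder_single)
  fix u w :: "('a, 'b) hvar"
  assume "w \<in> set (concat (map (\<lambda>e. [Lo (Circ e), Up (Circ e)])
      (sorted_list_of_set {e. n (Circ e) \<noteq> 0})))"
  then have "\<exists>e. w = Lo (Circ e) \<or> w = Up (Circ e)" by auto
  then show "?P u w" by (auto simp: reorder_single)
qed

lemma distinct_var_list: "distinct (var_list n)"
proof -
  have d: "distinct (concat (map f xs))"
    if "distinct xs" "\<And>x. distinct (f x)" "\<And>x y. x \<noteq> y \<Longrightarrow> set (f x) \<inter> set (f y) = {}"
    for f :: "'x \<Rightarrow> 'y list" and xs
    using that
  proof (induction xs)
    case (Cons x xs)
    have "set (f x) \<inter> set (f y) = {}" if "y \<in> set xs" for y
      using Cons.prems(1) that by (intro Cons.prems(3)) auto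
    then have "set (f x) \<inter> set (concat (map f xs)) = {}" by fastforce
    with Cons show ?case by simp
  qed simp
  show ?thesis
    unfolding var_list_def distinct_append
    by (intro conjI d) auto
qed

lemma std_monomial_basis:
  fixes n :: "('v::linorder, 'e::linorder) hedge \<Rightarrow> nat"
  assumes "finite {h. n h \<noteq> 0}"
  shows "std_monomial n = basis 1 (hedge_mset n)"
proof -
  let ?S = "{h. n h \<noteq> 0}"
  have fv1: "finite {v. n (At v s) \<noteq> 0}" for s
  proof -
    have "{v. n (At v s) \<noteq> 0} = (\<lambda>v. At v s) -` ?S" by blast
    moreover have "inj (\<lambda>v. At v s)" by (simp add: inj_def)
    ultimately show ?thesis using finite_vimageI[OF assms] by metis
  qed
  have "{v. \<exists>s. n (At v s) \<noteq> 0} =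
      {v. n (At v lft) \<noteq> 0} \<union> {v. n (At v mid) \<noteq> 0} \<union> {v. n (At v rgt) \<noteq> 0}"
    by (rule set_eqI) (simp, metis slot.exhaust)
  then have fv: "finite {v. \<exists>s. n (At v s) \<noteq> 0}" by (simp only: fv1 finite_Un simp_thms)
  have fc: "finite {e. n (Circ e) \<noteq> 0}"
  proof -
    have "{e. n (Circ e) \<noteq> 0} = Circ -` ?S" by blast
    moreover have "inj (Circ :: 'e \<Rightarrow> ('v, 'e) hedge)" by (simp add: inj_def)
    ultimately show ?thesis using finite_vimageI[OF assms] by metis
  qed
  let ?r = "\<lambda>u. replicate_mset (n (base u)) u"
  have mem: "Lo h \<in> set (var_list n) \<and> Up h \<in> set (var_list n)" if "n h \<noteq> 0" for h
  proof (cases h)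
    case (At v s)
    with that have v: "v \<in> set (sorted_list_of_set {v. \<exists>s. n (At v s) \<noteq> 0})"
      using fv by auto
    have "set [Lo (At v lft), Lo (At v mid), Lo (At v rgt),
               Up (At v rgt), Up (At v mid), Up (At v lft)] \<subseteq> set (var_list n)"
      unfolding var_list_def set_append set_concat set_map
      by (rule le_supI1, rule UN_upper, rule imageI[OF v])
    then show ?thesis unfolding At by (cases s) simp_all
  next
    case (Circ e)
    with that have e: "e \<in> set (sorted_list_of_set {e. n (Circ e) \<noteq> 0})"
      using fc by simp
    have "set [Lo (Circ e), Up (Circ e)] \<subseteq> set (var_list n)"
      unfolding var_list_def set_append set_concat set_map
      by (rule le_supI2, rule UN_upper, rule imageI[OF e])
    then show ?thesis unfolding Circ by simp
  qed
  have "(\<Sum>u\<leftarrow>var_list n. ?r u) = (\<Sum>u\<in>set (var_list n). ?r u)"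
    by (rule sum_list_distinct_conv_sum_set[OF distinct_var_list])
  also have "\<dots> = (\<Sum>u\<in>Lo ` ?S \<union> Up ` ?S. ?r u)"
  proof (rule sum.mono_neutral_right)
    show "Lo ` ?S \<union> Up ` ?S \<subseteq> set (var_list n)"
      using mem by blast
    show "\<forall>u\<in>set (var_list n) - (Lo ` ?S \<union> Up ` ?S). ?r u = {#}"
    proof
      fix u assume u: "u \<in> set (var_list n) - (Lo ` ?S \<union> Up ` ?S)"
      have "u = Lo (base u) \<or> u = Up (base u)" by (cases u) simp_all
      with u have "n (base u) = 0" by blast
      then show "?r u = {#}" by simp
    qed
  qed simp
  also have "\<dots> = (\<Sum>u\<in>Lo ` ?S. ?r u) + (\<Sum>u\<in>Up ` ?S. ?r u)"
    by (rule sum.union_disjoint) (use assms in auto)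
  also have "\<dots> = (\<Sum>h\<in>?S. replicate_mset (n h) (Lo h)) + (\<Sum>h\<in>?S. replicate_mset (n h) (Up h))"
    by (simp add: sum.reindex inj_on_def)
  also have "\<dots> = hedge_mset n"
    unfolding hedge_mset_def by (rule sum.distrib[symmetric])
  finally show ?thesis
    unfolding std_monomial_def by (simp only: ordered_prod_basis[OF sorted_var_list])
qed

lemma count_hedge_mset:
  assumes "finite {h. n h \<noteq> 0}"
  shows "count (hedge_mset n) (Lo h) = n h" "count (hedge_mset n) (Up h) = n h"
  using assms by (simp_all add: hedge_mset_def count_sum)


section \<open>The algebra of cycle variables\<close>

text \<open>The relations only see the half-edges of a cycle, so the generators are taken
  to be indexed by sets of half-edges; the cycle variables of a graph are those of the half-edge
  sets of its cycles.\<close>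

definition pairing :: "('v, 'e) hedge set \<Rightarrow> ('v, 'e) hedge set \<Rightarrow> rat" where
  "pairing C D = (of_nat (card {v. At v lft \<in> C \<and> At v rgt \<in> D}) -
                  of_nat (card {v. At v rgt \<in> C \<and> At v lft \<in> D})) / 2"

text \<open>The algebra with generators \<open>x\<^sub>C\<close> and relations \<open>x\<^sub>\<emptyset> = 1\<close> and
  \<open>x\<^sub>C x\<^sub>D = q\<^bsup>pairing C D\<^esup> x\<^sub>D x\<^sub>C\<close> over the coefficient ring: formal expressions
  modulo the congruence generated by the axioms of a unital algebra and the
  relations. In every graph \<open>C\<close> and \<open>D\<close> are finite.\<close>

datatype ('v, 'e) expr =
    Scal laurent
  | Gen "('v, 'e) hedge set"
  | Add "('v, 'e) expr" "('v, 'e) expr"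
  | Mul "('v, 'e) expr" "('v, 'e) expr"

inductive cyc_rel :: "('v, 'e) expr \<Rightarrow> ('v, 'e) expr \<Rightarrow> bool" (infix \<open>\<doteq>\<close> 50) where
  cr_refl: "s \<doteq> s"
| cr_sym: "s \<doteq> t \<Longrightarrow> t \<doteq> s"
| cr_trans: "s \<doteq> t \<Longrightarrow> t \<doteq> u \<Longrightarrow> s \<doteq> u"
| cr_add_cong: "s \<doteq> s' \<Longrightarrow> t \<doteq> t' \<Longrightarrow> Add s t \<doteq> Add s' t'"
| cr_mul_cong: "s \<doteq> s' \<Longrightarrow> t \<doteq> t' \<Longrightarrow> Mul s t \<doteq> Mul s' t'"
| cr_add_assoc: "Add (Add s t) u \<doteq> Add s (Add t u)"
| cr_add_commute: "Add s t \<doteq> Add t s"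
| cr_add_zero: "Add (Scal 0) s \<doteq> s"
| cr_add_inverse: "Add (Mul (Scal (- 1)) s) s \<doteq> Scal 0"
| cr_mul_assoc: "Mul (Mul s t) u \<doteq> Mul s (Mul t u)"
| cr_mul_one: "Mul (Scal 1) s \<doteq> s"
| cr_distrib_right: "Mul (Add s t) u \<doteq> Add (Mul s u) (Mul t u)"
| cr_distrib_left: "Mul s (Add t u) \<doteq> Add (Mul s t) (Mul s u)"
| cr_scal_add: "Add (Scal k) (Scal l) \<doteq> Scal (k + l)"
| cr_scal_mul: "Mul (Scal k) (Scal l) \<doteq> Scal (k * l)"
| cr_scal_central: "Mul (Scal k) s \<doteq> Mul s (Scal k)"
| cr_gen_empty: "Gen {} \<doteq> Scal 1"
| cr_gen_commute: "finite C \<Longrightarrow> finite D \<Longrightarrow>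
    Mul (Gen C) (Gen D) \<doteq> Mul (Scal (qp (pairing C D))) (Mul (Gen D) (Gen C))"

lemma equivp_cyc_rel: "equivp cyc_rel"
  by (intro equivpI reflpI sympI transpI) (fact cr_refl, fact cr_sym, fact cr_trans)

text \<open>The values of an expression in \<open>\<int>[q\<^sup>r, a\<^sup>s]\<langle>\<langle>z, Z\<rangle>\<rangle>\<close> under \<open>x\<^sub>C \<mapsto> z\<^sup>C Z\<^sup>C\<close>.\<close>

primrec mu_expr :: "('v::linorder, 'e::linorder) expr \<Rightarrow> ('v, 'e) qseries" where
  "mu_expr (Scal k) = const k"
| "mu_expr (Gen C) = std_monomial (\<lambda>h. of_bool (h \<in> C))"
| "mu_expr (Add s t) = mu_expr s + mu_expr t"
| "mu_expr (Mul s t) = mu_expr s * mu_expr t"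

primrec spec_expr :: "nat \<Rightarrow> ('v, 'e) expr \<Rightarrow> ('v, 'e) expr" where
  "spec_expr n (Scal k) = Scal (spec_coeff n k)"
| "spec_expr n (Gen C) = Gen C"
| "spec_expr n (Add s t) = Add (spec_expr n s) (spec_expr n t)"
| "spec_expr n (Mul s t) = Mul (spec_expr n s) (spec_expr n t)"

lemma std_monomial_commute:
  fixes C D :: "('v::linorder, 'e::linorder) hedge set"
  assumes "finite C" "finite D"
  shows "std_monomial (\<lambda>h. of_bool (h \<in> C)) * std_monomial (\<lambda>h. of_bool (h \<in> D)) =
    const (qp (pairing C D)) *
      (std_monomial (\<lambda>h. of_bool (h \<in> D)) * std_monomial (\<lambda>h. of_bool (h \<in> C)))"
proof -
  have inj: "inj (\<lambda>v. At v s)" for s by (auto simp: inj_def)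
  have fin: "finite {v. At v s \<in> A}" if "finite A" for A :: "('v, 'e) hedge set" and s
    using finite_vimageI[OF that inj[of s]] by (simp add: vimage_def)
  have fs: "finite {h. (of_bool (h \<in> A) :: nat) \<noteq> 0}" if "finite A" for A :: "('v, 'e) hedge set"
    using that by simp
  let ?M = "\<lambda>A::('v, 'e) hedge set. hedge_mset (\<lambda>h. of_bool (h \<in> A))"
  have ro: "reorder (?M A) (?M B) = pairing A B / 2" if A: "finite A" and B: "finite B" for A B
  proof -
    let ?V = "{v. At v lft \<in> A} \<union> {v. At v rgt \<in> A}"
    have V: "finite ?V" using fin[OF A] by simp
    let ?t = "\<lambda>v. (of_nat (of_bool (At v lft \<in> A) * of_bool (At v rgt \<in> B)) -
                     of_nat (of_bool (At v rgt \<in> A) * of_bool (At v lft \<in> B))) / (4::rat)"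
    have "reorder (?M A) (?M B) = Sum_any ?t"
      unfolding reorder_def count_hedge_mset[OF fs[OF A]] count_hedge_mset[OF fs[OF B]] ..
    also have "\<dots> = (\<Sum>v\<in>?V. ?t v)"
      by (rule Sum_any.expand_superset[OF V]) (auto split: if_splits)
    also have "\<dots> = ((\<Sum>v\<in>?V. of_bool (At v lft \<in> A \<and> At v rgt \<in> B)) -
                   (\<Sum>v\<in>?V. of_bool (At v rgt \<in> A \<and> At v lft \<in> B))) / 4"
      unfolding sum_subtractf[symmetric] sum_divide_distrib
      by (rule sum.cong) (simp_all add: of_bool_conj)
    also have "\<dots> = (of_nat (card (?V \<inter> {v. At v lft \<in> A \<and> At v rgt \<in> B})) -
                    of_nat (card (?V \<inter> {v. At v rgt \<in> A \<and> At v lft \<in> B}))) / 4"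
      using V by (simp only: sum_of_bool_eq)
    also have "?V \<inter> {v. At v lft \<in> A \<and> At v rgt \<in> B} = {v. At v lft \<in> A \<and> At v rgt \<in> B}"
      by auto
    also have "?V \<inter> {v. At v rgt \<in> A \<and> At v lft \<in> B} = {v. At v rgt \<in> A \<and> At v lft \<in> B}"
      by auto
    also have "(of_nat (card {v. At v lft \<in> A \<and> At v rgt \<in> B}) -
        of_nat (card {v. At v rgt \<in> A \<and> At v lft \<in> B})) / 4 = pairing A B / 2"
      by (simp add: pairing_def)
    finally show ?thesis .
  qed
  have anti: "pairing D C = - pairing C D"
    by (simp add: pairing_def conj_commute field_simps)
  have b: "std_monomial (\<lambda>h. of_bool (h \<in> A)) = basis 1 (?M A)" if "finite A" for A
    by (rule std_monomial_basis[OF fs[OF that]])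
  have "qp (pairing C D) * qp (pairing D C / 2) = qp (pairing C D / 2)"
    by (simp add: anti flip: qp_add)
  then show ?thesis
    unfolding b[OF assms(1)] b[OF assms(2)] basis_mult const_mult_basis
      ro[OF assms] ro[OF assms(2,1)] by (simp add: add.commute[of "?M D"])
qed

lemma mu_expr_respects: "s \<doteq> t \<Longrightarrow> mu_expr s = mu_expr t"
proof (induction rule: cyc_rel.induct)
  case (cr_refl s)
  show ?case by simp
next
  case (cr_sym s t)
  from cr_sym.IH show ?case by simp
next
  case (cr_trans s t u)
  from cr_trans.IH show ?case by simp
next
  case (cr_add_inverse s)
  have "mu_expr (Add (Mul (Scal (- 1)) s) s) = (const (- 1) + const 1) * mu_expr s"
    by (simp add: distrib_right)
  also have "\<dots> = 0" by (subst const_add[symmetric]) simp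
  finally show ?case by simp
next
  case (cr_scal_central k s)
  show ?case by (simp add: const_central)
next
  case cr_gen_empty
  show ?case by (simp add: std_monomial_def var_list_def)
next
  case (cr_gen_commute C D)
  then show ?case unfolding mu_expr.simps by (rule std_monomial_commute)
next
  case (cr_add_cong s s' t t')
  from cr_add_cong.IH show ?case by simp
next
  case (cr_mul_cong s s' t t')
  from cr_mul_cong.IH show ?case by simp
next
  case (cr_add_assoc s t u)
  show ?case by (simp add: add.assoc)
next
  case (cr_add_commute s t)
  show ?case by (simp add: add.commute)
next
  case (cr_add_zero s)
  show ?case by simp
next
  case (cr_mul_assoc s t u)
  show ?case by (simp add: mult.assoc)
next
  case (cr_mul_one s)
  show ?case by simp
next
  case (cr_distrib_right s t u)
  show ?case by (simp add: distrib_right)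
next
  case (cr_distrib_left s t u)
  show ?case by (simp add: distrib_left)
next
  case (cr_scal_add k l)
  show ?case by (simp add: const_add)
next
  case (cr_scal_mul k l)
  show ?case by (simp add: const_mult)
qed

lemma spec_coeff_minus_1: "spec_coeff n (- 1) = - 1"
proof -
  have "spec_coeff n (- 1) + spec_coeff n 1 = 0"
    using spec_coeff_add[of n "- 1" 1] by simp
  then show ?thesis by (simp add: eq_neg_iff_add_eq_0)
qed

lemma spec_expr_respects: "s \<doteq> t \<Longrightarrow> spec_expr n s \<doteq> spec_expr n t"
proof (induction rule: cyc_rel.induct)
  case (cr_sym s t)
  from cr_sym.IH show ?case by (rule cyc_rel.cr_sym)
next
  case (cr_trans s t u)
  from cr_trans.IH show ?case by (rule cyc_rel.cr_trans)
next
  case (cr_add_cong s s' t t')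
  from cr_add_cong.IH show ?case unfolding spec_expr.simps by (rule cyc_rel.cr_add_cong)
next
  case (cr_mul_cong s s' t t')
  from cr_mul_cong.IH show ?case unfolding spec_expr.simps by (rule cyc_rel.cr_mul_cong)
next
  case (cr_gen_commute C D)
  then show ?case unfolding spec_expr.simps spec_coeff_qp by (rule cyc_rel.cr_gen_commute)
qed (unfold spec_expr.simps spec_coeff_0 spec_coeff_1 spec_coeff_minus_1 spec_coeff_add
      spec_coeff_mult,
    (rule cyc_rel.cr_refl cyc_rel.cr_add_assoc cyc_rel.cr_add_commute cyc_rel.cr_add_zero
      cyc_rel.cr_add_inverse cyc_rel.cr_mul_assoc cyc_rel.cr_mul_one cyc_rel.cr_distrib_right
      cyc_rel.cr_distrib_left cyc_rel.cr_scal_add cyc_rel.cr_scal_mul cyc_rel.cr_scal_central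
      cyc_rel.cr_gen_empty)+)

primrec augment :: "('v, 'e) expr \<Rightarrow> laurent" where
  "augment (Scal k) = k"
| "augment (Gen C) = of_bool (C = {})"
| "augment (Add s t) = augment s + augment t"
| "augment (Mul s t) = augment s * augment t"

lemma augment_respects: "s \<doteq> t \<Longrightarrow> augment s = augment t"
proof (induction rule: cyc_rel.induct)
  case (cr_gen_commute C D)
  show ?case by (cases "C = {} \<or> D = {}") (auto simp: pairing_def)
qed (simp_all add: algebra_simps)

quotient_type ('v, 'e) cyc_alg = "('v, 'e) expr" / cyc_rel
  by (rule equivp_cyc_rel)

instantiation cyc_alg :: (type, type) ring_1
begin

lift_definition zero_cyc_alg :: "('a, 'b) cyc_alg" is "Scal 0" .
lift_definition one_cyc_alg :: "('a, 'b) cyc_alg" is "Scal 1" .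
lift_definition plus_cyc_alg :: "('a, 'b) cyc_alg \<Rightarrow> ('a, 'b) cyc_alg \<Rightarrow> ('a, 'b) cyc_alg"
  is Add by (rule cr_add_cong)
lift_definition uminus_cyc_alg :: "('a, 'b) cyc_alg \<Rightarrow> ('a, 'b) cyc_alg"
  is "Mul (Scal (- 1))" by (rule cr_mul_cong[OF cr_refl])
lift_definition minus_cyc_alg :: "('a, 'b) cyc_alg \<Rightarrow> ('a, 'b) cyc_alg \<Rightarrow> ('a, 'b) cyc_alg"
  is "\<lambda>s t. Add s (Mul (Scal (- 1)) t)"
  by (intro cr_add_cong cr_mul_cong[OF cr_refl])
lift_definition times_cyc_alg :: "('a, 'b) cyc_alg \<Rightarrow> ('a, 'b) cyc_alg \<Rightarrow> ('a, 'b) cyc_alg"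
  is Mul by (rule cr_mul_cong)

instance
proof
  fix f g h :: "('a, 'b) cyc_alg"
  show "f + g + h = f + (g + h)" by transfer (rule cr_add_assoc)
  show "f + g = g + f" by transfer (rule cr_add_commute)
  show "0 + f = f" by transfer (rule cr_add_zero)
  show "- f + f = 0" by transfer (rule cr_add_inverse)
  show "f - g = f + - g" by transfer (rule cr_refl)
  show "f * g * h = f * (g * h)" by transfer (rule cr_mul_assoc)
  show "1 * f = f" by transfer (rule cr_mul_one)
  show "f * 1 = f"
    by transfer (rule cr_trans[OF cr_sym[OF cr_scal_central] cr_mul_one])
  show "(f + g) * h = f * h + g * h" by transfer (rule cr_distrib_right)
  show "f * (g + h) = f * g + f * h" by transfer (rule cr_distrib_left)
  show "(0 :: ('a, 'b) cyc_alg) \<noteq> 1"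
  proof (transfer, rule notI)
    assume "(Scal 0 :: ('a, 'b) expr) \<doteq> Scal 1"
    from augment_respects[OF this] show False by simp
  qed
qed

end

lift_definition scal :: "laurent \<Rightarrow> ('v, 'e) cyc_alg" is Scal .

lift_definition gen :: "('v, 'e) hedge set \<Rightarrow> ('v, 'e) cyc_alg" is Gen .

text \<open>The homomorphism \<open>\<mu>\<close>.\<close>

lift_definition mu :: "('v::linorder, 'e::linorder) cyc_alg \<Rightarrow> ('v, 'e) qseries" is mu_expr
  by (rule mu_expr_respects)

text \<open>The substitution \<open>a\<^sup>1\<^sup>/\<^sup>2 = q\<^sup>n\<^sup>/\<^sup>2\<close> in the coefficients.\<close>

lift_definition spec_a :: "nat \<Rightarrow> ('v, 'e) cyc_alg \<Rightarrow> ('v, 'e) cyc_alg" is spec_expr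
  by (rule spec_expr_respects)

lemma gen_empty: "gen {} = 1"
  by transfer (rule cr_gen_empty)

lemma gen_commute:
  "finite C \<Longrightarrow> finite D \<Longrightarrow> gen C * gen D = scal (qp (pairing C D)) * (gen D * gen C)"
  by transfer (rule cr_gen_commute)

lemma mu_scal: "mu (scal k) = const k"
  by transfer simp

lemma mu_gen: "mu (gen C) = std_monomial (\<lambda>h. of_bool (h \<in> C))"
  by transfer simp

lemma mu_add: "mu (f + g) = mu f + mu g"
  by transfer simp

lemma mu_mult: "mu (f * g) = mu f * mu g"
  by transfer simp

lemma mu_1: "mu 1 = 1"
  by transfer simp

lemma spec_a_scal: "spec_a n (scal k) = scal (spec_coeff n k)"
  by transfer (simp add: cr_refl)

lemma spec_a_gen: "spec_a n (gen C) = gen C"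
  by transfer (simp add: cr_refl)

lemma spec_a_add: "spec_a n (f + g) = spec_a n f + spec_a n g"
  by transfer (simp add: cr_refl)

lemma spec_a_mult: "spec_a n (f * g) = spec_a n f * spec_a n g"
  by transfer (simp add: cr_refl)

lemma spec_a_1: "spec_a n 1 = 1"
  by transfer (simp add: cr_refl)


section \<open>States and the MOY evaluation\<close>

definition labels :: "nat \<Rightarrow> rat set" where
  "labels N = {of_nat k - (of_nat N - 1) / 2 |k. k < N}"

text \<open>States are set to \<open>{}\<close> outside the set of cycles, so that they are determined by their
  restriction to it. They live on connected cycles. Without this restriction the disjointness
  condition would permit both \<open>C\<close> and \<open>D\<close>, if they are disjoint, and also \<open>C \<union> D\<close> as carriers of
  the same label, and the state sum would overcount: for two disjoint circles \<open>C\<close>, \<open>D\<close> and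
  \<open>N = 1\<close>, the flow with value 1 on both would come from two states, one with
  \<open>\<sigma> C = \<sigma> D = {0}\<close> and one with \<open>\<sigma> (C \<union> D) = {0}\<close>, instead of one.\<close>

definition states :: "('v, 'e) moy_graph \<Rightarrow> nat \<Rightarrow> ('e set \<Rightarrow> rat set) set" where
  "states G N = {\<sigma>.
     (\<forall>C. \<sigma> C \<subseteq> labels N) \<and>
     (\<forall>C. C \<notin> cycles G \<longrightarrow> \<sigma> C = {}) \<and>
     \<sigma> {} = {} \<and>
     (\<forall>C\<in>cycles G. \<not> connected_cycle G C \<longrightarrow> \<sigma> C = {}) \<and>
     (\<forall>C\<in>cycles G. \<forall>D\<in>cycles G. C \<noteq> D \<and> C \<inter> D \<noteq> {} \<longrightarrow> \<sigma> C \<inter> \<sigma> D = {})}"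

definition edge_label ::
  "('v, 'e) moy_graph \<Rightarrow> ('e set \<Rightarrow> rat set) \<Rightarrow> 'e \<Rightarrow> rat set" where
  "edge_label G \<sigma> e = (\<Union>C\<in>{C \<in> cycles G. e \<in> C}. \<sigma> C)"

definition states_over ::
  "('v, 'e) moy_graph \<Rightarrow> nat \<Rightarrow> ('e \<Rightarrow> nat) \<Rightarrow> ('e set \<Rightarrow> rat set) set" where
  "states_over G N c = {\<sigma> \<in> states G N. \<forall>e\<in>edges G. card (edge_label G \<sigma> e) = c e}"

definition rot_state :: "('v, 'e) moy_graph \<Rightarrow> ('e set \<Rightarrow> rat set) \<Rightarrow> rat" where
  "rot_state G \<sigma> = (\<Sum>C\<in>cycles G. of_int (rot G C) * (\<Sum>x\<in>\<sigma> C. x))"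

definition lower_pairs ::
  "('v, 'e) moy_graph \<Rightarrow> ('e set \<Rightarrow> rat set) \<Rightarrow> 'v \<Rightarrow> nat" where
  "lower_pairs G \<sigma> v = card {(a, b). a \<in> edge_label G \<sigma> (hedge_edge G (At v lft)) \<and>
     b \<in> edge_label G \<sigma> (hedge_edge G (At v rgt)) \<and> a > b}"

definition upper_pairs ::
  "('v, 'e) moy_graph \<Rightarrow> ('e set \<Rightarrow> rat set) \<Rightarrow> 'v \<Rightarrow> nat" where
  "upper_pairs G \<sigma> v = card {(a, b). a \<in> edge_label G \<sigma> (hedge_edge G (At v lft)) \<and>
     b \<in> edge_label G \<sigma> (hedge_edge G (At v rgt)) \<and> a < b}"

definition vertex_weight ::
  "('v, 'e) moy_graph \<Rightarrow> ('e set \<Rightarrow> rat set) \<Rightarrow> 'v \<Rightarrow> laurent" where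
  "vertex_weight G \<sigma> v = qp ((of_nat (upper_pairs G \<sigma> v) - of_nat (lower_pairs G \<sigma> v)) / 4)"

definition moy_eval :: "('v, 'e) moy_graph \<Rightarrow> nat \<Rightarrow> ('e \<Rightarrow> nat) \<Rightarrow> laurent" where
  "moy_eval G N c = (\<Sum>\<sigma>\<in>states_over G N c.
     qp (rot_state G \<sigma>) * (\<Prod>v\<in>verts G. vertex_weight G \<sigma> v))"


section \<open>The generating series and the cycle polynomial\<close>

definition hedge_exponents ::
  "('v, 'e) moy_graph \<Rightarrow> ('e \<Rightarrow> nat) \<Rightarrow> ('v, 'e) hedge \<Rightarrow> nat" where
  "hedge_exponents G c h = (if h \<in> hedges G then c (hedge_edge G h) else 0)"

definition moy_series ::
  "('v::linorder, 'e::linorder) moy_graph \<Rightarrow> nat \<Rightarrow> ('v, 'e) qseries" where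
  "moy_series G N = formal_sum
     (\<lambda>c. const (moy_eval G N c) * std_monomial (hedge_exponents G c)) (colorings G)"

definition cycle_var :: "('v, 'e) moy_graph \<Rightarrow> 'e set \<Rightarrow> ('v, 'e) cyc_alg" where
  "cycle_var G C = gen {h \<in> hedges G. hedge_edge G h \<in> C}"

text \<open>The cycle polynomial as a function of the variables; \<open>(a\<^sup>-\<^sup>1\<^sup>/\<^sup>2 q\<^sup>1\<^sup>/\<^sup>2)\<^sup>r\<close> is
  \<open>a\<^sup>-\<^sup>r\<^sup>/\<^sup>2 q\<^sup>r\<^sup>/\<^sup>2\<close>.\<close>

definition cycle_poly ::
  "('v, 'e) moy_graph \<Rightarrow> ('e set \<Rightarrow> ('v, 'e) cyc_alg) \<Rightarrow> ('v, 'e) cyc_alg" where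
  "cycle_poly G y = (\<Sum>C\<in>cycles G.
     scal (ap (- of_int (rot G C) / 2) * qp (of_int (rot G C) / 2)) * y C)"

definition cycle_qprod :: "('v, 'e) moy_graph \<Rightarrow> nat \<Rightarrow> ('v, 'e) cyc_alg" where
  "cycle_qprod G N = (\<Prod>k\<leftarrow>[0..<N].
     cycle_poly G (\<lambda>C. scal (qp (of_nat k * of_int (rot G C))) * cycle_var G C))"

end

theory Submission
  imports Defs
begin

text \<open>
  With \<open>a = q\<^sup>N\<close> the \<open>k\<close>-th factor of the product is \<open>\<Sum>\<^sub>C q\<^bsup>x rot C\<^esup> x\<^sub>C\<close>, where
  \<open>x = k - (N - 1)/2\<close> is the \<open>k\<close>-th label. Expanding, the terms are indexed by tuples
  of cycles \<open>C\<^sub>0, \<dots>, C\<^bsub>N-1\<^esub>\<close>. Such a tuple is the same as a state: the carriers of the \<open>k\<close>-th label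
  are the connected components of \<open>C\<^sub>k\<close>. Indeed, connected cycles without a common edge
  have no common point either, since two cycles through the same trivalent vertex
  share its \<open>mid\<close> edge. Bringing the product of the monomials of \<open>C\<^sub>0, \<dots>, C\<^bsub>N-1\<^esub>\<close> into standard order
  produces, for \<open>i < j\<close>, a factor \<open>q\<^sup>1\<^sup>/\<^sup>4\<close> for each vertex with \<open>lft\<close> in \<open>C\<^sub>i\<close> and \<open>rgt\<close> in \<open>C\<^sub>j\<close>,
  and its inverse with \<open>lft\<close> and \<open>rgt\<close> interchanged; these are the vertex weights.
\<close>

section \<open>Cycles and their components\<close>

lemma UNIV_slot: "(UNIV :: slot set) = {lft, mid, rgt}"
  using slot.exhaust by blast

lemma Collect_slot:
  "{s. P s} = (if P lft then {lft} else {}) \<union> (if P mid then {mid} else {}) \<union>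
     (if P rgt then {rgt} else {})"
proof (rule set_eqI)
  fix s :: slot
  show "s \<in> {s. P s} \<longleftrightarrow> s \<in> (if P lft then {lft} else {}) \<union> (if P mid then {mid} else {}) \<union>
      (if P rgt then {rgt} else {})"
    by (cases s) auto
qed

locale planar_moy =
  fixes G :: "('v, 'e) moy_graph"
  assumes moy: "moy_graph G"
begin

section \<open>Edge curves, vertices and supports\<close>

lemma finite_verts: "finite (verts G)" and finite_edges: "finite (edges G)"
  using moy by (auto simp: moy_graph_def plane_graph_def)

lemma inj_vpos: "inj_on (vpos G) (verts G)"
  using moy by (auto simp: moy_graph_def plane_graph_def)

lemma path_curve: "e \<in> edges G \<Longrightarrow> path (curve G e)"
  using moy by (auto simp: moy_graph_def plane_graph_def simple_path_imp_path)

lemma curve_interior: "e \<in> edges G \<Longrightarrow> 0 < t \<Longrightarrow> t < 1 \<Longrightarrow> curve G e t \<notin> vpos G ` verts G"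
  using moy by (auto simp: moy_graph_def plane_graph_def)

lemma curves_meet:
  "e \<in> edges G \<Longrightarrow> e' \<in> edges G \<Longrightarrow> e \<noteq> e' \<Longrightarrow>
    path_image (curve G e) \<inter> path_image (curve G e') \<subseteq> vpos G ` verts G"
  using moy unfolding moy_graph_def plane_graph_def by blast

lemma midpoint_in_curve: "curve G e (1/2) \<in> path_image (curve G e)"
  by (auto simp: path_image_def)

text \<open>Two curves meet only at vertices, and the interior of a curve avoids all vertices; so
  the midpoint marks its edge.\<close>

lemma midpoint_unique:
  assumes "e \<in> edges G" "e' \<in> edges G" "curve G e (1/2) \<in> path_image (curve G e')"
  shows "e = e'"
proof (rule ccontr)
  assume "e \<noteq> e'"
  then have "curve G e (1/2) \<in> vpos G ` verts G"
    using curves_meet[OF assms(1,2)] midpoint_in_curve[of e] assms(3) by blast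
  then show False using curve_interior[OF assms(1), of "1/2"] by simp
qed

text \<open>By the midpoints, an edge set can be recovered from its support. This translates between
  topological components and sets of edges.\<close>

lemma support_subsetD:
  assumes "D \<subseteq> edges G" "D' \<subseteq> edges G" "support G D \<subseteq> support G D'"
  shows "D \<subseteq> D'"
proof
  fix e assume e: "e \<in> D"
  then have "curve G e (1/2) \<in> support G D'"
    using assms(3) midpoint_in_curve[of e] by (auto simp: support_def)
  then obtain e' where "e' \<in> D'" "curve G e (1/2) \<in> path_image (curve G e')"
    by (auto simp: support_def)
  then show "e \<in> D'" using midpoint_unique[of e e'] e assms by blast
qed

lemma incident:
  assumes "e \<in> edges G" "v \<in> verts G" "vpos G v \<in> path_image (curve G e)"
  shows "e \<in> in_edges G v \<union> out_edges G v"
proof -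
  obtain t where t: "0 \<le> t" "t \<le> 1" "curve G e t = vpos G v"
    using assms(3) by (auto simp: path_image_def)
  then have "t = 0 \<or> t = 1"
    using curve_interior[OF assms(1), of t] assms(2) by fastforce
  then show ?thesis
    using t assms(1) by (auto simp: in_edges_def out_edges_def pathstart_def pathfinish_def)
qed

lemma vpos_in_curve:
  assumes "e \<in> in_edges G v \<union> out_edges G v"
  shows "vpos G v \<in> path_image (curve G e)"
  using assms pathstart_in_path_image[of "curve G e"] pathfinish_in_path_image[of "curve G e"]
  by (auto simp: in_edges_def out_edges_def)

section \<open>Cycles near a vertex\<close>

lemma cycle_subset: "C \<in> cycles G \<Longrightarrow> C \<subseteq> edges G"
  by (simp add: cycles_def)

lemma finite_cycles: "finite (cycles G)"
  by (rule finite_subset[of _ "Pow (edges G)"]) (auto simp: cycles_def finite_edges)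

lemma finite_in_out: "finite (in_edges G v)" "finite (out_edges G v)"
  using finite_edges by (auto simp: in_edges_def out_edges_def)

text \<open>In one of the two directions \<open>v\<close> has a single edge, and every cycle through
  \<open>v\<close> must use it.\<close>

lemma cycles_meet_at_vertex:
  assumes "C \<in> cycles G" "D \<in> cycles G" "v \<in> verts G"
    and "C \<inter> (in_edges G v \<union> out_edges G v) \<noteq> {}"
    and "D \<inter> (in_edges G v \<union> out_edges G v) \<noteq> {}"
  shows "C \<inter> D \<noteq> {}"
proof -
  have one: "card (in_edges G v \<inter> X) = 1" "card (out_edges G v \<inter> X) = 1"
    if "X \<in> cycles G" "X \<inter> (in_edges G v \<union> out_edges G v) \<noteq> {}" for X
  proof -
    have "card (in_edges G v \<inter> X) \<noteq> 0 \<or> card (out_edges G v \<inter> X) \<noteq> 0"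
      using that(2) finite_in_out[of v] by auto
    then show "card (in_edges G v \<inter> X) = 1" "card (out_edges G v \<inter> X) = 1"
      using that(1) assms(3) by (auto simp: cycles_def)
  qed
  have full: "A \<subseteq> X" if "finite A" "card A = 1" "card (A \<inter> X) = 1" for A X :: "'e set"
    using that card_subset_eq[of A "A \<inter> X"] by auto
  have "card (in_edges G v) = 1 \<or> card (out_edges G v) = 1"
    using moy assms(3) by (auto simp: moy_graph_def trivalent_no_sink_source_def)
  then obtain A where A: "A \<in> {in_edges G v, out_edges G v}" "card A = 1" by auto
  have "finite A" "card (A \<inter> C) = 1" "card (A \<inter> D) = 1"
    using A(1) one[OF assms(1,4)] one[OF assms(2,5)] finite_in_out[of v] by auto
  then have "A \<subseteq> C" "A \<subseteq> D" using full A(2) by blast+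
  moreover have "A \<noteq> {}" using A(2) by auto
  ultimately show ?thesis by blast
qed

text \<open>A common point would be a vertex on both cycles, and there they would share an
  edge.\<close>

lemma disjoint_support:
  assumes "C \<in> cycles G" "D \<in> cycles G" "C \<inter> D = {}"
  shows "support G C \<inter> support G D = {}"
proof (rule ccontr)
  assume "support G C \<inter> support G D \<noteq> {}"
  then obtain z e e' where z: "e \<in> C" "e' \<in> D" "z \<in> path_image (curve G e)"
    "z \<in> path_image (curve G e')"
    by (auto simp: support_def)
  have e: "e \<in> edges G" "e' \<in> edges G" "e \<noteq> e'" using z assms cycle_subset by blast+
  then obtain v where v: "v \<in> verts G" "z = vpos G v"
    using curves_meet[of e e'] z by blast
  have "e \<in> in_edges G v \<union> out_edges G v" "e' \<in> in_edges G v \<union> out_edges G v"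
    using incident e z v by auto
  then show False using cycles_meet_at_vertex[OF assms(1,2) v(1)] z assms(3) by blast
qed

text \<open>The conditions on a cycle concern one vertex at a time, so different vertices may use
  different cycles \<open>C\<close> as local models.\<close>

lemma cyclesI_local:
  assumes "D \<subseteq> edges G"
    and "\<And>v. v \<in> verts G \<Longrightarrow> D \<inter> (in_edges G v \<union> out_edges G v) \<noteq> {} \<Longrightarrow>
      \<exists>C\<in>cycles G. D \<inter> (in_edges G v \<union> out_edges G v) = C \<inter> (in_edges G v \<union> out_edges G v)"
  shows "D \<in> cycles G"
  unfolding cycles_def
proof (rule CollectI, intro conjI assms(1) ballI)
  fix v assume v: "v \<in> verts G"
  have "\<exists>C\<in>cycles G. D \<inter> (in_edges G v \<union> out_edges G v) = C \<inter> (in_edges G v \<union> out_edges G v)"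
  proof (cases "D \<inter> (in_edges G v \<union> out_edges G v) = {}")
    case True
    \<comment> \<open>Where \<open>D\<close> has no edge, the empty cycle is the local
      model.\<close>
    moreover have "{} \<in> cycles G" by (simp add: cycles_def)
    ultimately show ?thesis by blast
  qed (use assms(2)[OF v] in blast)
  then obtain C where C: "C \<in> cycles G" "in_edges G v \<inter> D = in_edges G v \<inter> C"
    "out_edges G v \<inter> D = out_edges G v \<inter> C"
    by blast
  then show "card (in_edges G v \<inter> D) + card (out_edges G v \<inter> D) \<in> {0, 2}"
    "card (in_edges G v \<inter> D) = card (out_edges G v \<inter> D)"
    using v unfolding C(2,3) by (auto simp: cycles_def)
qed

section \<open>Topological components of the support of a cycle\<close>

lemma connected_curve: "e \<in> edges G \<Longrightarrow> connected (path_image (curve G e))"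
  using path_curve connected_path_image by blast

lemma closed_support: "D \<subseteq> edges G \<Longrightarrow> closed (support G D)"
  unfolding support_def using finite_subset[OF _ finite_edges] path_curve
  by (intro closed_UN) (auto intro: closed_path_image)

lemma curve_subset_component:
  assumes "C \<subseteq> edges G" "K \<in> components (support G C)" "e \<in> C"
    "path_image (curve G e) \<inter> K \<noteq> {}"
  shows "path_image (curve G e) \<subseteq> K"
  using assms connected_curve
  by (intro components_maximal[OF assms(2)]) (auto simp: support_def)

text \<open>A curve is connected, so it lies in every component that it meets; a component is
  therefore a union of curves.\<close>

lemma component_support:
  assumes "C \<subseteq> edges G" "K \<in> components (support G C)"
  shows "support G {e \<in> C. path_image (curve G e) \<subseteq> K} = K"
proof
  show "K \<subseteq> support G {e \<in> C. path_image (curve G e) \<subseteq> K}"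
  proof
    fix z assume z: "z \<in> K"
    then have "z \<in> support G C" using assms(2) in_components_subset by blast
    then obtain e where e: "e \<in> C" "z \<in> path_image (curve G e)" by (auto simp: support_def)
    then have "path_image (curve G e) \<subseteq> K"
      using curve_subset_component[OF assms e(1)] z by blast
    then show "z \<in> support G {e \<in> C. path_image (curve G e) \<subseteq> K}"
      using e by (auto simp: support_def)
  qed
qed (auto simp: support_def)

lemma cycle_component_connected:
  assumes C: "C \<in> cycles G" and D: "D \<in> cycle_components G C"
  shows "connected_cycle G D"
proof -
  let ?K = "support G D"
  have K: "?K \<in> components (support G C)" and DC: "D \<subseteq> C"
    using D by (auto simp: cycle_components_def)
  have CE: "C \<subseteq> edges G" using cycle_subset[OF C] .
  have "D \<in> cycles G"
  proof (rule cyclesI_local)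
    show "D \<subseteq> edges G" using CE DC by blast
    fix v assume v: "v \<in> verts G" "D \<inter> (in_edges G v \<union> out_edges G v) \<noteq> {}"
    then have vK: "vpos G v \<in> ?K" using vpos_in_curve[of _ v] by (auto simp: support_def)
    \<comment> \<open>Every edge of \<open>C\<close> at \<open>v\<close> passes through a point of
      the component and so belongs to \<open>D\<close>; hence \<open>D\<close> looks like
      \<open>C\<close> at \<open>v\<close>.\<close>
    have "e \<in> D" if e: "e \<in> C" "e \<in> in_edges G v \<union> out_edges G v" for e
    proof -
      have "path_image (curve G e) \<subseteq> ?K"
        using curve_subset_component[OF CE K e(1)] vpos_in_curve[OF e(2)] vK by blast
      then have "support G {e} \<subseteq> ?K" by (simp add: support_def)
      then show ?thesis using support_subsetD[of "{e}" D] e(1) CE DC by blast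
    qed
    then show "\<exists>C\<in>cycles G. D \<inter> (in_edges G v \<union> out_edges G v) =
        C \<inter> (in_edges G v \<union> out_edges G v)"
      using C DC by blast
  qed
  moreover have "D \<noteq> {}"
    using in_components_nonempty[OF K] by (auto simp: support_def)
  ultimately show ?thesis
    using in_components_connected[OF K] by (simp add: connected_cycle_def)
qed

text \<open>The midpoint of a shared edge lies in both supports; these are components, so they
  coincide, and the support determines the edge set.\<close>

lemma cycle_components_disjoint:
  assumes C: "C \<in> cycles G" and "D \<in> cycle_components G C" "D' \<in> cycle_components G C"
    "D \<inter> D' \<noteq> {}"
  shows "D = D'"
proof -
  have "support G D \<inter> support G D' \<noteq> {}"
    using assms(4) midpoint_in_curve by (auto simp: support_def)
  then have "support G D = support G D'"
    using components_nonoverlap assms(2,3) by (fastforce simp: cycle_components_def)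
  moreover have "D \<subseteq> edges G" "D' \<subseteq> edges G"
    using assms cycle_subset[OF C] by (auto simp: cycle_components_def)
  ultimately show ?thesis using support_subsetD[of D D'] support_subsetD[of D' D] by auto
qed

lemma Union_cycle_components:
  assumes C: "C \<in> cycles G"
  shows "\<Union>(cycle_components G C) = C"
proof
  show "C \<subseteq> \<Union>(cycle_components G C)"
  proof
    fix e assume e: "e \<in> C"
    have CE: "C \<subseteq> edges G" using cycle_subset[OF C] .
    have "curve G e (1/2) \<in> support G C"
      using e midpoint_in_curve by (auto simp: support_def)
    then obtain K where K: "K \<in> components (support G C)" "curve G e (1/2) \<in> K"
      using Union_components[of "support G C"] by blast
    have "path_image (curve G e) \<subseteq> K"
      using curve_subset_component[OF CE K(1) e] K(2) midpoint_in_curve by blast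
    then show "e \<in> \<Union>(cycle_components G C)"
      using e K(1) component_support[OF CE K(1)]
      by (intro UnionI[of "{e \<in> C. path_image (curve G e) \<subseteq> K}"])
         (auto simp: cycle_components_def)
  qed
qed (auto simp: cycle_components_def)

text \<open>Converse of the decomposition into components: the supports are finitely many disjoint
  closed connected sets, so each is a component of their union.\<close>

lemma Union_disjoint_cycles:
  assumes conn: "\<And>D. D \<in> F \<Longrightarrow> connected_cycle G D"
    and disj: "\<And>D D'. D \<in> F \<Longrightarrow> D' \<in> F \<Longrightarrow> D \<noteq> D' \<Longrightarrow> D \<inter> D' = {}"
  shows "\<Union>F \<in> cycles G" and "cycle_components G (\<Union>F) = F"
proof -
  have cyc: "D \<in> cycles G" if "D \<in> F" for D
    using conn[OF that] by (simp add: connected_cycle_def)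
  have finF: "finite F" using finite_subset[OF _ finite_cycles] cyc by blast
  have FE: "\<Union>F \<subseteq> edges G" using cyc cycle_subset by blast
  show "\<Union>F \<in> cycles G"
  proof (rule cyclesI_local[OF FE])
    fix v assume v: "v \<in> verts G" "\<Union>F \<inter> (in_edges G v \<union> out_edges G v) \<noteq> {}"
    then obtain D where D: "D \<in> F" "D \<inter> (in_edges G v \<union> out_edges G v) \<noteq> {}" by blast
    \<comment> \<open>Only one member of \<open>F\<close> passes through \<open>v\<close>, so the
      union looks like this member there.\<close>
    have "D' = D" if "D' \<in> F" "D' \<inter> (in_edges G v \<union> out_edges G v) \<noteq> {}" for D'
      using cycles_meet_at_vertex[OF cyc[OF that(1)] cyc[OF D(1)] v(1) that(2) D(2)]
        disj that(1) D(1) by blast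
    then have "\<Union>F \<inter> (in_edges G v \<union> out_edges G v) = D \<inter> (in_edges G v \<union> out_edges G v)"
      using D(1) by blast
    then show "\<exists>C\<in>cycles G. \<Union>F \<inter> (in_edges G v \<union> out_edges G v) =
        C \<inter> (in_edges G v \<union> out_edges G v)"
      using cyc[OF D(1)] by blast
  qed
  let ?S = "support G (\<Union>F)"
  have S: "?S = (\<Union>D\<in>F. support G D)" by (auto simp: support_def)
  have comp: "support G D \<in> components ?S" if D: "D \<in> F" for D
    unfolding in_components_maximal
  proof (intro conjI allI impI)
    obtain e where "e \<in> D" using conn[OF D] by (auto simp: connected_cycle_def)
    then show ne: "support G D \<noteq> {}" using midpoint_in_curve by (auto simp: support_def)
    show "support G D \<subseteq> ?S" using D by (auto simp: S)
    show "connected (support G D)" using conn[OF D] by (simp add: connected_cycle_def)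
    fix T assume T: "T \<noteq> {} \<and> support G D \<subseteq> T \<and> T \<subseteq> ?S \<and> connected T"
    \<comment> \<open>The connected set \<open>T\<close> is covered by the disjoint closed sets
      \<open>support G D\<close> and \<open>?R\<close>, so it lies in the first.\<close>
    let ?R = "\<Union>D'\<in>F - {D}. support G D'"
    have cl: "closed ?R" "closed (support G D)"
      using finF cyc cycle_subset closed_support D by auto
    have "support G D \<inter> ?R = {}"
      using disjoint_support[OF cyc[OF D] cyc] disj[OF D] by blast
    then have meet: "support G D \<inter> ?R \<inter> T = {}" by blast
    have cover: "T \<subseteq> support G D \<union> ?R" using T unfolding S by blast
    have "support G D \<inter> T = {} \<or> ?R \<inter> T = {}"
      using connected_closedD[OF _ meet cover cl(2,1)] T by simp
    then have "?R \<inter> T = {}" using T ne by blast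
    then have "T \<subseteq> support G D" using cover by blast
    then show "T = support G D" using T by simp
  qed
  show "cycle_components G (\<Union>F) = F"
  proof
    show "F \<subseteq> cycle_components G (\<Union>F)" using comp by (auto simp: cycle_components_def)
    show "cycle_components G (\<Union>F) \<subseteq> F"
    proof
      fix D assume D: "D \<in> cycle_components G (\<Union>F)"
      then have K: "support G D \<in> components ?S" "D \<subseteq> edges G"
        using FE by (auto simp: cycle_components_def)
      then obtain z where z: "z \<in> support G D" "z \<in> ?S"
        using in_components_nonempty in_components_subset by blast
      then obtain D' where D': "D' \<in> F" "z \<in> support G D'" unfolding S by blast
      then have "support G D = support G D'"
        using components_nonoverlap[OF K(1) comp[OF D'(1)]] z(1) by blast
      then have "D = D'"
        using support_subsetD[of D D'] support_subsetD[of D' D] K(2) cycle_subset[OF cyc[OF D'(1)]]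
        by auto
      then show "D \<in> F" using D' by simp
    qed
  qed
qed

lemma rot_connected_cycle:
  assumes "connected_cycle G C"
  shows "rot G C = rot_connected G C"
  using Union_disjoint_cycles(2)[of "{C}"] assms by (simp add: rot_def)


section \<open>States as tuples of cycles\<close>

text \<open>Numbers \<open>labels N\<close> increasingly, so that labels can be compared through
  their indices.\<close>

definition label :: "nat \<Rightarrow> nat \<Rightarrow> rat" where
  "label N k = of_nat k - (of_nat N - 1) / 2"

text \<open>Extensional functions: a tuple is determined by its entries below \<open>N\<close>, and
  there are only finitely many tuples.\<close>

definition tuples :: "nat \<Rightarrow> (nat \<Rightarrow> 'e set) set" where
  "tuples N = ({..<N} \<rightarrow>\<^sub>E cycles G)"

definition state_of :: "nat \<Rightarrow> (nat \<Rightarrow> 'e set) \<Rightarrow> 'e set \<Rightarrow> rat set" where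
  "state_of N \<tau> D = label N ` {k. k < N \<and> D \<in> cycle_components G (\<tau> k)}"

text \<open>Inverse of \<open>state_of\<close> on states; the restricted lambda produces the default
  value required of extensional functions.\<close>

definition tuple_of :: "nat \<Rightarrow> ('e set \<Rightarrow> rat set) \<Rightarrow> nat \<Rightarrow> 'e set" where
  "tuple_of N \<sigma> = (\<lambda>k\<in>{..<N}. \<Union>{D. label N k \<in> \<sigma> D})"

lemma labels_eq: "labels N = label N ` {..<N}"
  by (auto simp: labels_def label_def)

lemma label_eq_iff [simp]: "label N i = label N j \<longleftrightarrow> i = j"
  by (simp add: label_def)

lemma label_less_iff [simp]: "label N i < label N j \<longleftrightarrow> i < j"
  by (simp add: label_def)

lemma inj_label: "inj_on (label N) A"
  by (simp add: inj_on_def)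

lemma finite_tuples: "finite (tuples N)"
  by (simp add: tuples_def finite_cycles finite_PiE)

lemma tuples_cycles: "\<tau> \<in> tuples N \<Longrightarrow> k < N \<Longrightarrow> \<tau> k \<in> cycles G"
  by (auto simp: tuples_def)

text \<open>Different components of one entry share no edge, so two cycles with a common edge never
  carry the same label.\<close>

lemma state_of_states:
  assumes \<tau>: "\<tau> \<in> tuples N"
  shows "state_of N \<tau> \<in> states G N"
proof -
  have conn: "connected_cycle G D" if "state_of N \<tau> D \<noteq> {}" for D
    using that cycle_component_connected tuples_cycles[OF \<tau>] by (auto simp: state_of_def)
  have "state_of N \<tau> C \<inter> state_of N \<tau> D = {}" if "C \<noteq> D" "C \<inter> D \<noteq> {}" for C D
  proof -
    have "\<not> (C \<in> cycle_components G (\<tau> k) \<and> D \<in> cycle_components G (\<tau> k))" if "k < N" for k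
      using cycle_components_disjoint[OF tuples_cycles[OF \<tau> that], of C D] \<open>C \<noteq> D\<close> \<open>C \<inter> D \<noteq> {}\<close>
      by blast
    then show ?thesis by (auto simp: state_of_def)
  qed
  moreover have "state_of N \<tau> C \<subseteq> labels N" for C
    by (auto simp: state_of_def labels_eq)
  moreover have "state_of N \<tau> C = {}" if "C \<notin> cycles G \<or> C = {} \<or> \<not> connected_cycle G C" for C
    using that conn[of C] by (auto simp: connected_cycle_def)
  ultimately show ?thesis by (simp add: states_def)
qed

text \<open>The carriers of one label are connected, and pairwise disjoint by the condition on
  states; so they are the components of their union.\<close>

lemma tuple_of_components:
  assumes \<sigma>: "\<sigma> \<in> states G N" and k: "k < N"
  shows "tuple_of N \<sigma> k \<in> cycles G"
    and "cycle_components G (tuple_of N \<sigma> k) = {D. label N k \<in> \<sigma> D}"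
proof -
  let ?F = "{D. label N k \<in> \<sigma> D}"
  have conn: "connected_cycle G D" if "D \<in> ?F" for D
    using that \<sigma> by (auto simp: states_def)
  have "D \<inter> D' = {}" if "D \<in> ?F" "D' \<in> ?F" "D \<noteq> D'" for D D'
    using that conn[OF that(1)] conn[OF that(2)] \<sigma> unfolding states_def connected_cycle_def
    by blast
  from Union_disjoint_cycles[of ?F, OF conn this]
  show "tuple_of N \<sigma> k \<in> cycles G"
    "cycle_components G (tuple_of N \<sigma> k) = {D. label N k \<in> \<sigma> D}"
    using k by (simp_all add: tuple_of_def)
qed

lemma bij_state_of: "bij_betw (state_of N) (tuples N) (states G N)"
proof (rule bij_betw_byWitness[where f' = "tuple_of N"])
  show "\<forall>\<tau>\<in>tuples N. tuple_of N (state_of N \<tau>) = \<tau>"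
  proof (intro ballI ext)
    fix \<tau> k assume \<tau>: "\<tau> \<in> tuples N"
    show "tuple_of N (state_of N \<tau>) k = \<tau> k"
    proof (cases "k < N")
      case True
      then have "{D. label N k \<in> state_of N \<tau> D} = cycle_components G (\<tau> k)"
        by (auto simp: state_of_def)
      then show ?thesis
        using True Union_cycle_components tuples_cycles[OF \<tau>] by (simp add: tuple_of_def)
    next
      case False
      then show ?thesis
        using PiE_arb[of \<tau> "{..<N}" "\<lambda>_. cycles G" k] \<tau> by (simp add: tuple_of_def tuples_def)
    qed
  qed
  show "\<forall>\<sigma>\<in>states G N. state_of N (tuple_of N \<sigma>) = \<sigma>"
  proof (intro ballI ext)
    fix \<sigma> D assume \<sigma>: "\<sigma> \<in> states G N"
    then have "\<sigma> D \<subseteq> label N ` {..<N}" by (auto simp: states_def labels_eq)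
    then show "state_of N (tuple_of N \<sigma>) D = \<sigma> D"
      using tuple_of_components(2)[OF \<sigma>] by (auto simp: state_of_def)
  qed
  show "state_of N ` tuples N \<subseteq> states G N" using state_of_states by blast
  show "tuple_of N ` states G N \<subseteq> tuples N"
    using tuple_of_components(1) by (auto simp: tuples_def tuple_of_def PiE_iff)
qed

section \<open>Labels, rotation number, flow and weights of the state of a tuple\<close>

lemma edge_label_state_of:
  assumes \<tau>: "\<tau> \<in> tuples N"
  shows "edge_label G (state_of N \<tau>) e = label N ` {k. k < N \<and> e \<in> \<tau> k}"
proof -
  have "e \<in> \<tau> k \<longleftrightarrow> (\<exists>D\<in>cycles G. e \<in> D \<and> D \<in> cycle_components G (\<tau> k))" if "k < N" for k
    using Union_cycle_components[OF tuples_cycles[OF \<tau> that]]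
      cycle_component_connected[OF tuples_cycles[OF \<tau> that]]
    by (auto simp: connected_cycle_def)
  then show ?thesis unfolding edge_label_def state_of_def by blast
qed

text \<open>Exchanging the sums over cycles and labels collects, for each \<open>k\<close>, the
  components of \<open>\<tau> k\<close>, whose rotation numbers add up to that of
  \<open>\<tau> k\<close>.\<close>

lemma rot_state_of:
  assumes \<tau>: "\<tau> \<in> tuples N"
  shows "rot_state G (state_of N \<tau>) = (\<Sum>k<N. label N k * of_int (rot G (\<tau> k)))"
proof -
  let ?K = "\<lambda>D. {k. k < N \<and> D \<in> cycle_components G (\<tau> k)}"
  have comp: "cycle_components G (\<tau> k) \<subseteq> cycles G" if "k < N" for k
    using cycle_component_connected[OF tuples_cycles[OF \<tau> that]] by (auto simp: connected_cycle_def)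
  have "rot_state G (state_of N \<tau>) = (\<Sum>D\<in>cycles G. of_int (rot G D) * (\<Sum>k\<in>?K D. label N k))"
    by (simp add: rot_state_def state_of_def sum.reindex[OF inj_label])
  also have "\<dots> = (\<Sum>D\<in>cycles G. \<Sum>k<N.
      if D \<in> cycle_components G (\<tau> k) then of_int (rot G D) * label N k else 0)"
    by (intro sum.cong refl)
       (simp add: sum_distrib_left sum.inter_filter[symmetric] lessThan_def)
  also have "\<dots> = (\<Sum>k<N. \<Sum>D\<in>cycles G.
      if D \<in> cycle_components G (\<tau> k) then of_int (rot G D) * label N k else 0)"
    by (rule sum.swap)
  also have "\<dots> = (\<Sum>k<N. label N k * of_int (rot G (\<tau> k)))"
  proof (rule sum.cong[OF refl])
    fix k assume "k \<in> {..<N}"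
    then have k: "k < N" by simp
    have "(\<Sum>D\<in>cycles G.
        if D \<in> cycle_components G (\<tau> k) then of_int (rot G D) * label N k else 0) =
      (\<Sum>D\<in>cycle_components G (\<tau> k). of_int (rot G D) * label N k)"
      using comp[OF k] finite_cycles by (simp add: sum.If_cases Int_absorb1)
    also have "\<dots> = label N k * of_int (rot G (\<tau> k))"
      using rot_connected_cycle[OF cycle_component_connected[OF tuples_cycles[OF \<tau> k]]]
      by (simp add: rot_def[of G "\<tau> k"] sum_distrib_left mult.commute)
    finally show "(\<Sum>D\<in>cycles G.
        if D \<in> cycle_components G (\<tau> k) then of_int (rot G D) * label N k else 0) =
      label N k * of_int (rot G (\<tau> k))" .
  qed
  finally show ?thesis .
qed

definition tuple_flow :: "nat \<Rightarrow> (nat \<Rightarrow> 'e set) \<Rightarrow> 'e \<Rightarrow> nat" where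
  "tuple_flow N \<tau> e = (\<Sum>k<N. of_bool (e \<in> \<tau> k))"

lemma card_edge_label:
  assumes \<tau>: "\<tau> \<in> tuples N"
  shows "card (edge_label G (state_of N \<tau>) e) = tuple_flow N \<tau> e"
proof -
  have "{k. k < N \<and> e \<in> \<tau> k} = {..<N} \<inter> {k. e \<in> \<tau> k}" by auto
  then show ?thesis
    by (simp add: edge_label_state_of[OF \<tau>] card_image[OF inj_label] tuple_flow_def sum_of_bool_eq)
qed

text \<open>The indicator function of a cycle is a flow, and sums of flows are flows.\<close>

lemma tuple_flow_coloring:
  assumes \<tau>: "\<tau> \<in> tuples N"
  shows "tuple_flow N \<tau> \<in> colorings G"
proof -
  have "tuple_flow N \<tau> e = 0" if "e \<notin> edges G" for e
    using that cycle_subset[OF tuples_cycles[OF \<tau>]] by (auto simp: tuple_flow_def)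
  moreover have "(\<Sum>e\<in>in_edges G v. tuple_flow N \<tau> e) = (\<Sum>e\<in>out_edges G v. tuple_flow N \<tau> e)"
    if v: "v \<in> verts G" for v
  proof -
    have "(\<Sum>e\<in>A. tuple_flow N \<tau> e) = (\<Sum>k<N. card (A \<inter> \<tau> k))" if "finite A" for A
      unfolding tuple_flow_def using that by (subst sum.swap) (simp add: sum_of_bool_eq)
    moreover have "card (in_edges G v \<inter> \<tau> k) = card (out_edges G v \<inter> \<tau> k)" if "k < N" for k
      using tuples_cycles[OF \<tau> that] v by (auto simp: cycles_def)
    ultimately show ?thesis using finite_in_out by simp
  qed
  ultimately show ?thesis by (simp add: colorings_def)
qed

text \<open>Contribution of a vertex \<open>v\<close> to twice the \<open>pairing\<close> of the
  half-edge sets of \<open>C\<close> and \<open>D\<close>.\<close>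

definition pair_weight :: "'e set \<Rightarrow> 'e set \<Rightarrow> 'v \<Rightarrow> int" where
  "pair_weight C D v =
     of_bool (fst (germ G v lft) \<in> C \<and> fst (germ G v rgt) \<in> D) -
     of_bool (fst (germ G v rgt) \<in> C \<and> fst (germ G v lft) \<in> D)"

text \<open>Labels increase with the index, so the label pairs become index pairs
  \<open>i < j\<close>: \<open>upper_pairs\<close> counts those with \<open>lft\<close> in
  \<open>\<tau> i\<close> and \<open>rgt\<close> in \<open>\<tau> j\<close>,
  \<open>lower_pairs\<close> those with the slots exchanged.\<close>

lemma vertex_weight_state_of:
  assumes \<tau>: "\<tau> \<in> tuples N"
  shows "vertex_weight G (state_of N \<tau>) v =
    qp ((\<Sum>j<N. \<Sum>i<j. of_int (pair_weight (\<tau> i) (\<tau> j) v)) / 4)"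
proof -
  let ?l = "fst (germ G v lft)" and ?r = "fst (germ G v rgt)"
  \<comment> \<open>Index pairs are written \<open>(j, i)\<close>, the larger index first.\<close>
  let ?P = "SIGMA j:{..<N}. {..<j}"
  have card: "of_nat (card {p \<in> ?P. Q p}) = (\<Sum>j<N. \<Sum>i<j. of_bool (Q (j, i)) :: rat)" for Q
  proof -
    have "(\<Sum>j<N. \<Sum>i<j. of_bool (Q (j, i)) :: rat) = (\<Sum>p\<in>?P. of_bool (Q p))"
      by (subst sum.Sigma) (auto simp: split_beta)
    also have "\<dots> = of_nat (card (?P \<inter> {p. Q p}))" by (rule sum_of_bool_eq) auto
    also have "?P \<inter> {p. Q p} = {p \<in> ?P. Q p}" by blast
    finally show ?thesis by simp
  qed
  have "upper_pairs G (state_of N \<tau>) v =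
      card ((\<lambda>(j, i). (label N i, label N j)) ` {p \<in> ?P. ?l \<in> \<tau> (snd p) \<and> ?r \<in> \<tau> (fst p)})"
    unfolding upper_pairs_def edge_label_state_of[OF \<tau>] hedge_edge.simps
    by (rule arg_cong[where f = card]) (force simp: image_iff)
  then have upper: "upper_pairs G (state_of N \<tau>) v =
      card {p \<in> ?P. ?l \<in> \<tau> (snd p) \<and> ?r \<in> \<tau> (fst p)}"
    by (simp add: card_image inj_on_def split_beta prod_eq_iff)
  have "lower_pairs G (state_of N \<tau>) v =
      card ((\<lambda>(j, i). (label N j, label N i)) ` {p \<in> ?P. ?r \<in> \<tau> (snd p) \<and> ?l \<in> \<tau> (fst p)})"
    unfolding lower_pairs_def edge_label_state_of[OF \<tau>] hedge_edge.simps
    by (rule arg_cong[where f = card]) (force simp: image_iff)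
  then have lower: "lower_pairs G (state_of N \<tau>) v =
      card {p \<in> ?P. ?r \<in> \<tau> (snd p) \<and> ?l \<in> \<tau> (fst p)}"
    by (simp add: card_image inj_on_def split_beta prod_eq_iff)
  show ?thesis
    unfolding vertex_weight_def upper lower card pair_weight_def
    by (simp add: sum_subtractf)
qed

section \<open>Half-edge monomials of cycles\<close>

definition cycle_hedges :: "'e set \<Rightarrow> ('v, 'e) hedge set" where
  "cycle_hedges C = {h \<in> hedges G. hedge_edge G h \<in> C}"

text \<open>Exponents of the standard monomial to which \<open>mu\<close> sends the cycle variable
  of \<open>C\<close>.\<close>

definition cycle_mset :: "'e set \<Rightarrow> ('v, 'e) hvar multiset" where
  "cycle_mset C = hedge_mset (\<lambda>h. of_bool (h \<in> cycle_hedges C))"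

lemma finite_hedges: "finite (hedges G)"
proof -
  have "hedges G \<subseteq> (\<lambda>(v, s). At v s) ` (verts G \<times> UNIV) \<union> Circ ` edges G"
    by (auto simp: hedges_def circle_edges_def)
  then show ?thesis
    by (rule finite_subset) (simp add: finite_verts finite_edges UNIV_slot)
qed

lemma finite_cycle_hedges: "finite (cycle_hedges C)"
  using finite_hedges by (simp add: cycle_hedges_def)

lemma At_hedges: "At v s \<in> cycle_hedges C \<longleftrightarrow> v \<in> verts G \<and> fst (germ G v s) \<in> C"
  by (auto simp: cycle_hedges_def hedges_def)

lemma finite_support: "finite {h. hedge_exponents G c h \<noteq> 0}"
  by (rule finite_subset[OF _ finite_hedges]) (auto simp: hedge_exponents_def)

text \<open>The flow is the sum of the indicators of the entries, so the product of the entries'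
  monomials has the exponents of the coloring.\<close>

lemma hedge_mset_tuple_flow:
  "hedge_mset (hedge_exponents G (tuple_flow N \<tau>)) = (\<Sum>k<N. cycle_mset (\<tau> k))"
proof (rule multiset_eqI)
  fix u
  have count: "count (hedge_mset n) u = n (base u)" if "finite {h. n h \<noteq> 0}"
    for n :: "('v, 'e) hedge \<Rightarrow> nat"
    by (cases u) (simp_all add: count_hedge_mset[OF that])
  have "count (cycle_mset C) u = of_bool (base u \<in> cycle_hedges C)" for C
    unfolding cycle_mset_def by (rule count) (simp add: finite_cycle_hedges)
  then show "count (hedge_mset (hedge_exponents G (tuple_flow N \<tau>))) u =
      count (\<Sum>k<N. cycle_mset (\<tau> k)) u"
    unfolding count[OF finite_support] count_sum
    by (simp add: cycle_hedges_def hedge_exponents_def tuple_flow_def del: sum_of_bool_eq)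
qed

text \<open>The upper variables account for \<open>lft\<close> in \<open>C\<close> and
  \<open>rgt\<close> in \<open>D\<close>, the lower ones for the exchanged slots with opposite sign.
  This is the source of the vertex weights.\<close>

lemma reorder_cycle_mset:
  "reorder (cycle_mset C) (cycle_mset D) = (\<Sum>v\<in>verts G. of_int (pair_weight C D v)) / 4"
proof -
  let ?t = "\<lambda>v. (of_nat (of_bool (At v lft \<in> cycle_hedges C) * of_bool (At v rgt \<in> cycle_hedges D)) -
      of_nat (of_bool (At v rgt \<in> cycle_hedges C) * of_bool (At v lft \<in> cycle_hedges D))) / (4::rat)"
  have fin: "finite {h. (of_bool (h \<in> cycle_hedges X) :: nat) \<noteq> 0}" for X
    by (simp add: finite_cycle_hedges)
  have "reorder (cycle_mset C) (cycle_mset D) = Sum_any ?t"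
    unfolding reorder_def cycle_mset_def count_hedge_mset[OF fin] ..
  also have "\<dots> = (\<Sum>v\<in>verts G. ?t v)"
    by (rule Sum_any.expand_superset[OF finite_verts]) (auto simp: At_hedges)
  also have "\<dots> = (\<Sum>v\<in>verts G. of_int (pair_weight C D v)) / 4"
    unfolding sum_divide_distrib
    by (rule sum.cong) (simp_all add: At_hedges pair_weight_def)
  finally show ?thesis .
qed

section \<open>Parity of the pairing of two cycles\<close>

lemma sum_germs:
  fixes f :: "'e \<Rightarrow> 'a::comm_monoid_add"
  assumes v: "v \<in> verts G"
  shows "(\<Sum>e\<in>in_edges G v. f e) = (\<Sum>s\<in>{s. \<not> snd (germ G v s)}. f (fst (germ G v s)))"
    and "(\<Sum>e\<in>out_edges G v. f e) = (\<Sum>s\<in>{s. snd (germ G v s)}. f (fst (germ G v s)))"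
proof -
  have bij: "bij_betw (germ G v) UNIV (germs_at G v)"
    using moy v by (auto simp: moy_graph_def germ_labelling_def)
  \<comment> \<open>Germs of one direction correspond to edges of that direction; a loop has one
    germ in each.\<close>
  have b: "bij_betw (\<lambda>s. fst (germ G v s)) {s. snd (germ G v s) = b}
      (if b then out_edges G v else in_edges G v)" for b
  proof (rule bij_betw_imageI)
    show "inj_on (\<lambda>s. fst (germ G v s)) {s. snd (germ G v s) = b}"
      using bij_betw_imp_inj_on[OF bij] by (auto simp: inj_on_def prod_eq_iff)
    have "(\<lambda>s. fst (germ G v s)) ` {s. snd (germ G v s) = b} =
        fst ` {g \<in> range (germ G v). snd g = b}" by auto
    also have "\<dots> = (if b then out_edges G v else in_edges G v)"
      unfolding bij_betw_imp_surj_on[OF bij] by (cases b) (auto simp: germs_at_def image_iff)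
    finally show "(\<lambda>s. fst (germ G v s)) ` {s. snd (germ G v s) = b} =
        (if b then out_edges G v else in_edges G v)" .
  qed
  show "(\<Sum>e\<in>in_edges G v. f e) = (\<Sum>s\<in>{s. \<not> snd (germ G v s)}. f (fst (germ G v s)))"
    using sum.reindex_bij_betw[OF b[of False], of f] by simp
  show "(\<Sum>e\<in>out_edges G v. f e) = (\<Sum>s\<in>{s. snd (germ G v s)}. f (fst (germ G v s)))"
    using sum.reindex_bij_betw[OF b[of True], of f] by simp
qed

text \<open>Modulo 2 and by the flow condition, \<open>pair_weight C D v\<close> is the number of germs at \<open>v\<close>
  that belong to both \<open>C\<close> and \<open>D\<close>, and every edge has either two germs or none.\<close>

lemma even_sum_pair_weight:
  assumes C: "C \<in> cycles G" and D: "D \<in> cycles G"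
  shows "even (\<Sum>v\<in>verts G. pair_weight C D v)"
proof -
  let ?f = "\<lambda>e. of_bool (e \<in> C \<and> e \<in> D) :: int"
  have local: "even (pair_weight C D v - ((\<Sum>e\<in>in_edges G v. ?f e) + (\<Sum>e\<in>out_edges G v. ?f e)))"
    if v: "v \<in> verts G" for v
  proof -
    have flow: "(\<Sum>e\<in>in_edges G v. of_bool (e \<in> X) :: int) = (\<Sum>e\<in>out_edges G v. of_bool (e \<in> X))"
      if "X \<in> cycles G" for X
      using that v finite_in_out[of v] by (simp add: cycles_def sum_of_bool_eq)
    have "snd (germ G v lft) = snd (germ G v rgt)" "snd (germ G v mid) \<noteq> snd (germ G v lft)"
      using moy v by (auto simp: moy_graph_def germ_labelling_def)
    then consider
        "{s. snd (germ G v s)} = {mid}" "{s. \<not> snd (germ G v s)} = {lft, rgt}"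
      | "{s. snd (germ G v s)} = {lft, rgt}" "{s. \<not> snd (germ G v s)} = {mid}"
      unfolding Collect_slot[of "\<lambda>s. snd (germ G v s)"] Collect_slot[of "\<lambda>s. \<not> snd (germ G v s)"]
      by (cases "snd (germ G v mid)") auto
    note slots = this
    have split: "of_bool (fst (germ G v mid) \<in> X) =
        (of_bool (fst (germ G v lft) \<in> X) + of_bool (fst (germ G v rgt) \<in> X) :: int)"
      if "X \<in> cycles G" for X
      using slots
    proof cases
      case 1
      show ?thesis
        using flow[OF that] unfolding sum_germs[OF v] 1 by (simp del: sum_of_bool_eq)
    next
      case 2
      show ?thesis
        using flow[OF that] unfolding sum_germs[OF v] 2 by (simp del: sum_of_bool_eq)
    qed
    have total: "(\<Sum>e\<in>in_edges G v. ?f e) + (\<Sum>e\<in>out_edges G v. ?f e) =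
        ?f (fst (germ G v mid)) + ?f (fst (germ G v lft)) + ?f (fst (germ G v rgt))"
      using slots
    proof cases
      case 1
      show ?thesis unfolding sum_germs[OF v] 1 by (simp del: sum_of_bool_eq)
    next
      case 2
      show ?thesis unfolding sum_germs[OF v] 2 by (simp del: sum_of_bool_eq)
    qed
    \<comment> \<open>With \<open>m = l + r\<close> for both cycles,
      \<open>m_C m_D + l_C l_D + r_C r_D\<close> and \<open>l_C r_D - r_C l_D\<close> differ by an
      even number.\<close>
    show ?thesis
      using split[OF C] split[OF D] unfolding total pair_weight_def
      by (cases "fst (germ G v lft) \<in> C"; cases "fst (germ G v rgt) \<in> C";
          cases "fst (germ G v lft) \<in> D"; cases "fst (germ G v rgt) \<in> D") auto
  qed
  have inj: "(\<Sum>v\<in>verts G. \<Sum>e | e \<in> edges G \<and> p e = vpos G v. ?f e) =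
      (\<Sum>e | e \<in> edges G \<and> p e \<in> vpos G ` verts G. ?f e)" for p :: "'e \<Rightarrow> complex"
  proof -
    have "(\<Sum>v\<in>verts G. \<Sum>e | e \<in> edges G \<and> p e = vpos G v. ?f e) =
        (\<Sum>e\<in>(\<Union>v\<in>verts G. {e. e \<in> edges G \<and> p e = vpos G v}). ?f e)"
      using inj_vpos
      by (intro sum.UNION_disjoint[symmetric]) (auto simp: finite_verts finite_edges inj_on_def)
    also have "(\<Union>v\<in>verts G. {e. e \<in> edges G \<and> p e = vpos G v}) =
        {e. e \<in> edges G \<and> p e \<in> vpos G ` verts G}" by auto
    finally show ?thesis .
  qed
  \<comment> \<open>Circles have no end at a vertex and all other edges have both ends there, so
    initial and final ends give equal sums, with an even total.\<close>
  have ends: "pathfinish (curve G e) \<in> vpos G ` verts G \<longleftrightarrow> pathstart (curve G e) \<in> vpos G ` verts G"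
    if "e \<in> edges G" for e
    using moy that by (auto simp: moy_graph_def plane_graph_def circle_edges_def)
  then have "{e. e \<in> edges G \<and> pathfinish (curve G e) \<in> vpos G ` verts G} =
      {e. e \<in> edges G \<and> pathstart (curve G e) \<in> vpos G ` verts G}" by blast
  then have eq: "(\<Sum>v\<in>verts G. \<Sum>e\<in>in_edges G v. ?f e) = (\<Sum>v\<in>verts G. \<Sum>e\<in>out_edges G v. ?f e)"
    unfolding in_edges_def out_edges_def inj by simp
  have "even (\<Sum>v\<in>verts G. pair_weight C D v -
      ((\<Sum>e\<in>in_edges G v. ?f e) + (\<Sum>e\<in>out_edges G v. ?f e)))"
    using local by (rule dvd_sum)
  then show ?thesis unfolding sum_subtractf sum.distrib eq by simp
qed

text \<open>The exponent of \<open>q\<close> with which a tuple enters both expansions: first the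
  rotation part, then the cost of standard ordering.\<close>

definition tuple_exponent :: "nat \<Rightarrow> (nat \<Rightarrow> 'e set) \<Rightarrow> rat" where
  "tuple_exponent N \<tau> = (\<Sum>k<N. label N k * of_int (rot G (\<tau> k))) +
     (\<Sum>j<N. \<Sum>i<j. reorder (cycle_mset (\<tau> i)) (cycle_mset (\<tau> j)))"

text \<open>Single vertices contribute multiples of 1/4; the parity of the sum over all vertices
  makes the total for each pair of entries a half-integer, as the labels are.\<close>

lemma tuple_exponent_half_integer:
  assumes \<tau>: "\<tau> \<in> tuples N"
  shows "2 * tuple_exponent N \<tau> \<in> \<int>"
proof -
  have "2 * reorder (cycle_mset (\<tau> i)) (cycle_mset (\<tau> j)) \<in> \<int>" if ij: "i < N" "j < N" for i j
  proof -
    obtain m where "(\<Sum>v\<in>verts G. pair_weight (\<tau> i) (\<tau> j) v) = 2 * m"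
      using even_sum_pair_weight[OF tuples_cycles[OF \<tau> ij(1)] tuples_cycles[OF \<tau> ij(2)]]
      by (rule evenE)
    then have "(\<Sum>v\<in>verts G. of_int (pair_weight (\<tau> i) (\<tau> j) v)) = (of_int (2 * m) :: rat)"
      by (simp only: flip: of_int_sum)
    then show ?thesis by (simp add: reorder_cycle_mset)
  qed
  moreover have "2 * label N k = of_int (2 * int k - (int N - 1))" for k
    by (simp add: label_def field_simps)
  ultimately show ?thesis
    unfolding tuple_exponent_def distrib_left sum_distrib_left mult.assoc[symmetric]
    by (intro Ints_add Ints_sum) auto
qed

end

section \<open>Expansion of the generating series and of the product\<close>

lemma qp_sum: "qp (\<Sum>x\<in>A. f x) = (\<Prod>x\<in>A. qp (f x))"
  by (induction A rule: infinite_finite_induct) (simp_all add: qp_add)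

lemma scoeff_sum: "scoeff (\<Sum>x\<in>A. f x) M = (\<Sum>x\<in>A. scoeff (f x) M)"
  by (induction A rule: infinite_finite_induct)
     (simp_all add: zero_qseries.rep_eq plus_qseries.rep_eq)

lemma reorder_sum_left: "reorder (\<Sum>x\<in>A. f x) B = (\<Sum>x\<in>A. reorder (f x) B)"
  by (induction A rule: infinite_finite_induct) (simp_all add: reorder_add_left)

text \<open>Appending the factor \<open>N\<close> costs \<open>reorder\<close> of all earlier
  exponents against \<open>M N\<close>, which splits into one term for each
  \<open>i < N\<close>.\<close>

lemma basis_prod_list:
  "(\<Prod>k\<leftarrow>[0..<N]. basis (c k) (M k)) =
     basis (qp (\<Sum>j<N. \<Sum>i<j. reorder (M i) (M j)) * (\<Prod>k<N. c k)) (\<Sum>k<N. M k)"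
  by (induction N) (simp_all add: basis_one basis_mult reorder_sum_left qp_add mult_ac)

text \<open>Distributivity without commutativity: the factors keep their order, and the induction
  splits off the last one on the right.\<close>

lemma prod_list_sum_PiE:
  fixes f :: "nat \<Rightarrow> 'a \<Rightarrow> 'b::semiring_1"
  shows "(\<Prod>k\<leftarrow>[0..<N]. \<Sum>a\<in>A. f k a) = (\<Sum>\<tau>\<in>{..<N} \<rightarrow>\<^sub>E A. \<Prod>k\<leftarrow>[0..<N]. f k (\<tau> k))"
proof (induction N)
  case (Suc N)
  let ?P = "\<lambda>\<tau>. \<Prod>k\<leftarrow>[0..<N]. f k (\<tau> k)"
  \<comment> \<open>The first \<open>N\<close> factors do not see entry \<open>N\<close>.\<close>
  have upd: "?P (\<tau>(N := a)) = ?P \<tau>" for \<tau> a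
    by (rule arg_cong[where f = prod_list], rule map_cong) auto
  have "(\<Sum>\<tau>\<in>{..<Suc N} \<rightarrow>\<^sub>E A. \<Prod>k\<leftarrow>[0..<Suc N]. f k (\<tau> k)) =
      (\<Sum>(a, \<tau>)\<in>A \<times> ({..<N} \<rightarrow>\<^sub>E A). ?P \<tau> * f N a)"
    unfolding lessThan_Suc PiE_insert_eq
    by (subst sum.reindex[OF inj_combinator]) (auto simp: upd fun_upd_same split_beta simp del: fun_upd_apply)
  also have "\<dots> = (\<Sum>\<tau>\<in>{..<N} \<rightarrow>\<^sub>E A. \<Sum>a\<in>A. ?P \<tau> * f N a)"
    by (subst sum.cartesian_product[symmetric]) (rule sum.swap)
  finally show ?case by (simp add: Suc.IH sum_product)
qed simp

section \<open>\<open>mu\<close> and \<open>spec_a\<close> on sums and products\<close>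

lemma mu_0: "mu 0 = 0"
  using mu_add[of 0 0] by simp

lemma spec_a_0: "spec_a n 0 = 0"
  using spec_a_add[of n 0 0] by simp

lemma mu_sum: "mu (\<Sum>x\<in>A. f x) = (\<Sum>x\<in>A. mu (f x))"
  by (induction A rule: infinite_finite_induct) (simp_all add: mu_0 mu_add)

lemma spec_a_sum: "spec_a n (\<Sum>x\<in>A. f x) = (\<Sum>x\<in>A. spec_a n (f x))"
  by (induction A rule: infinite_finite_induct) (simp_all add: spec_a_0 spec_a_add)

lemma mu_spec_a_prod_list:
  "mu (spec_a n (\<Prod>x\<leftarrow>xs. f x)) = (\<Prod>x\<leftarrow>xs. mu (spec_a n (f x)))"
  by (induction xs) (simp_all add: spec_a_1 mu_1 spec_a_mult mu_mult)

section \<open>Coefficients with half-integral exponents\<close>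

lemma half_laurent_qp: "2 * r \<in> \<int> \<Longrightarrow> qp r \<in> half_laurent"
  by (simp add: half_laurent_def qp_def)

lemma half_laurent_0: "0 \<in> half_laurent"
  by (simp add: half_laurent_def)

lemma half_laurent_sum:
  "(\<And>x. x \<in> A \<Longrightarrow> f x \<in> half_laurent) \<Longrightarrow> (\<Sum>x\<in>A. f x) \<in> half_laurent"
proof (induction A rule: infinite_finite_induct)
  case (insert x A)
  then have "f x \<in> half_laurent" "(\<Sum>x\<in>A. f x) \<in> half_laurent" by simp_all
  then have "f x + (\<Sum>x\<in>A. f x) \<in> half_laurent"
    using Poly_Mapping.keys_add[of "f x" "\<Sum>x\<in>A. f x"] unfolding half_laurent_def by blast
  then show ?case using insert by simp
qed (simp_all add: half_laurent_0)

section \<open>Both sides as sums over tuples of cycles\<close>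

locale ordered_planar_moy = planar_moy G for G :: "('v::linorder, 'e::linorder) moy_graph"
begin

text \<open>The bijection \<open>state_of\<close> turns the state sum into a sum over tuples, and
  the product of the vertex weights gives the reordering part of the exponent.\<close>

lemma moy_eval_tuples:
  assumes c: "c \<in> colorings G"
  shows "moy_eval G N c = (\<Sum>\<tau>\<in>{\<tau> \<in> tuples N. tuple_flow N \<tau> = c}. qp (tuple_exponent N \<tau>))"
proof -
  let ?T = "{\<tau> \<in> tuples N. tuple_flow N \<tau> = c}"
  \<comment> \<open>Both \<open>c\<close> and the flow of a tuple vanish off the edges, so agreement
    on edges is equality.\<close>
  have flow: "(\<forall>e\<in>edges G. card (edge_label G (state_of N \<tau>) e) = c e) \<longleftrightarrow> tuple_flow N \<tau> = c"
    if "\<tau> \<in> tuples N" for \<tau>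
    using tuple_flow_coloring[OF that] c unfolding card_edge_label[OF that] colorings_def fun_eq_iff
    by force
  have "states_over G N c = {\<sigma> \<in> state_of N ` tuples N. \<forall>e\<in>edges G. card (edge_label G \<sigma> e) = c e}"
    by (simp add: states_over_def bij_betw_imp_surj_on[OF bij_state_of])
  also have "\<dots> = state_of N ` ?T" using flow by auto
  finally have over: "states_over G N c = state_of N ` ?T" .
  have inj: "inj_on (state_of N) ?T"
    using bij_betw_imp_inj_on[OF bij_state_of] by (rule inj_on_subset) blast
  have "qp (rot_state G (state_of N \<tau>)) * (\<Prod>v\<in>verts G. vertex_weight G (state_of N \<tau>) v) =
      qp (tuple_exponent N \<tau>)" if \<tau>: "\<tau> \<in> tuples N" for \<tau>
  proof -
    have "(\<Sum>v\<in>verts G. (\<Sum>j<N. \<Sum>i<j. of_int (pair_weight (\<tau> i) (\<tau> j) v)) / 4) =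
        (\<Sum>j<N. \<Sum>i<j. reorder (cycle_mset (\<tau> i)) (cycle_mset (\<tau> j)))"
      unfolding reorder_cycle_mset sum_divide_distrib
      by (subst sum.swap) (rule sum.cong[OF refl], rule sum.swap)
    then show ?thesis
      by (simp add: rot_state_of[OF \<tau>] vertex_weight_state_of[OF \<tau>] tuple_exponent_def qp_add
          flip: qp_sum)
  qed
  then show ?thesis
    unfolding moy_eval_def over sum.reindex[OF inj] by simp
qed

text \<open>Tuples are grouped by their flow; a coloring that is not the flow of a tuple has
  evaluation 0, so the formal sum is finite.\<close>

lemma moy_series_tuples:
  "moy_series G N =
     (\<Sum>\<tau>\<in>tuples N. basis (qp (tuple_exponent N \<tau>)) (\<Sum>k<N. cycle_mset (\<tau> k)))"
proof (rule qseries_eqI)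
  fix M :: "('v, 'e) hvar multiset"
  let ?m = "\<lambda>c. hedge_mset (hedge_exponents G c)"
  let ?F = "\<lambda>c. scoeff (const (moy_eval G N c) * std_monomial (hedge_exponents G c)) M"
  let ?t = "\<lambda>\<tau>. if M = ?m (tuple_flow N \<tau>) then qp (tuple_exponent N \<tau>) else 0"
  let ?C = "tuple_flow N ` tuples N"
  have CC: "?C \<subseteq> colorings G" using tuple_flow_coloring by blast
  have F: "?F c = (\<Sum>\<tau>\<in>{\<tau> \<in> tuples N. tuple_flow N \<tau> = c}. ?t \<tau>)" if "c \<in> colorings G" for c
    by (auto simp: std_monomial_basis[OF finite_support] moy_eval_tuples[OF that] intro: sum.cong)
  have "scoeff (moy_series G N) M = (\<Sum>c\<in>{c \<in> colorings G. ?F c \<noteq> 0}. ?F c)"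
    by (simp add: moy_series_def formal_sum_def Series_inverse)
  also have "\<dots> = (\<Sum>c\<in>?C. ?F c)"
  proof (rule sum.mono_neutral_left)
    show "{c \<in> colorings G. ?F c \<noteq> 0} \<subseteq> ?C"
    proof
      fix c assume "c \<in> {c \<in> colorings G. ?F c \<noteq> 0}"
      then have "{\<tau> \<in> tuples N. tuple_flow N \<tau> = c} \<noteq> {}" using F[of c] by force
      then show "c \<in> ?C" by blast
    qed
    show "\<forall>c\<in>?C - {c \<in> colorings G. ?F c \<noteq> 0}. ?F c = 0" using CC by blast
  qed (simp add: finite_tuples)
  also have "\<dots> = (\<Sum>c\<in>?C. \<Sum>\<tau>\<in>{\<tau> \<in> tuples N. tuple_flow N \<tau> = c}. ?t \<tau>)"
    using F CC by (intro sum.cong refl) blast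
  also have "\<dots> = (\<Sum>\<tau>\<in>tuples N. ?t \<tau>)"
    by (rule sum.group) (simp_all add: finite_tuples)
  finally show "scoeff (moy_series G N) M =
      scoeff (\<Sum>\<tau>\<in>tuples N. basis (qp (tuple_exponent N \<tau>)) (\<Sum>k<N. cycle_mset (\<tau> k))) M"
    by (simp add: scoeff_sum hedge_mset_tuple_flow)
qed

lemma mu_cycle_poly:
  "mu (spec_a N (cycle_poly G (\<lambda>C. scal (qp (of_nat k * of_int (rot G C))) * cycle_var G C))) =
     (\<Sum>C\<in>cycles G. basis (qp (label N k * of_int (rot G C))) (cycle_mset C))"
proof -
  have mono: "std_monomial (\<lambda>h. of_bool (h \<in> cycle_hedges C)) = basis 1 (cycle_mset C)" for C
    unfolding cycle_mset_def by (rule std_monomial_basis) (simp add: finite_cycle_hedges)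
  \<comment> \<open>The specialisation of \<open>a\<close>, the cycle polynomial and the rescaling
    of the variables give \<open>-N/2 + 1/2 + k = k - (N - 1)/2\<close>, the label.\<close>
  have "qp (of_nat N * (- r / 2)) * qp (r / 2) * (qp (of_nat k * r)) = qp (label N k * r)" for r
    by (simp add: label_def field_simps flip: qp_add)
  then show ?thesis
    unfolding cycle_poly_def cycle_var_def cycle_hedges_def[symmetric]
    by (simp add: spec_a_sum mu_sum spec_a_mult mu_mult spec_a_scal mu_scal spec_a_gen mu_gen
        spec_coeff_mult mono const_mult_basis mult.assoc)
qed

text \<open>Choosing a term in every factor means choosing a tuple; the coefficients give the
  rotation part of its exponent, the multiplication of monomials the other part.\<close>

lemma mu_cycle_qprod:
  "mu (spec_a N (cycle_qprod G N)) =
     (\<Sum>\<tau>\<in>tuples N. basis (qp (tuple_exponent N \<tau>)) (\<Sum>k<N. cycle_mset (\<tau> k)))"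
  unfolding cycle_qprod_def mu_spec_a_prod_list mu_cycle_poly prod_list_sum_PiE basis_prod_list
    tuples_def tuple_exponent_def
  by (simp add: mult.commute qp_add flip: qp_sum)

lemma scoeff_moy_series_half_laurent: "scoeff (moy_series G N) M \<in> half_laurent"
  unfolding moy_series_tuples scoeff_sum
  by (rule half_laurent_sum)
     (simp add: half_laurent_0 half_laurent_qp tuple_exponent_half_integer)

end

theorem theorem1p2:
  fixes G :: "('v::linorder, 'e::linorder) moy_graph" and N :: nat
  assumes "moy_graph G" and "N \<ge> 1"
  shows "moy_series G N = mu (spec_a N (cycle_qprod G N)) \<and>
    (\<forall>M. scoeff (moy_series G N) M \<in> half_laurent)"
proof -
  interpret ordered_planar_moy G
    by unfold_locales (rule assms(1))
  show ?thesis
    using scoeff_moy_series_half_laurent by (simp add: moy_series_tuples mu_cycle_qprod)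
qed

end
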